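(* For any convex body $K\subset\mathbb{R}^n$ and any continuous map $f : K\to \mathbb{R}^{n-1}$ there exists a fiber $f^{-1}(y)$ of $1$-dimensional Hausdorff measure at least $w(K)$. The estimate is tight for any $K$, that is, \[ \inf_{f : K \to \mathbb{R}^{n-1}\ \text{continuous}}\ \sup_{y\in \mathbb{R}^{n-1}} \mathcal{H}^1(f^{-1}(y)) = w(K); \] in particular $\gamma_1(K) = w(K)$.
   Context: A convex body is a compact convex set with nonempty interior. $w(K)$ is the minimal width of $K$, i.e. the minimal distance between two parallel support hyperplanes of $K$. $\mathcal{H}^1$ is the $1$-dimensional Hausdorff measure. For $X\subset\mathbb{R}^n$, \[ \gamma_{n-k} (X) = \inf_{f : X \to \mathbb{R}^k\ \text{continuous}}\ \sup_{y\in \mathbb{R}^k} \underline{\mathcal M}_{n-k} f^{-1}(y), \] (here with $k=n-1$), where the lower Minkowski content is \[ \underline{\mathcal M}_{n-k} Z = \liminf_{t \to+0} \frac{\mathrm{vol}_n(\nu_t Z)}{v_{k} t^k}, \] $\nu_t Z$ is the set of points of $\mathbb{R}^n$ at distance less than $t$ from $Z$, and $v_k$ is the volume of the unit Euclidean $k$-dimensional ball. *)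

theory Defs
  imports "HOL-Analysis.Analysis"
begin

definition convex_body :: "'a::euclidean_space set \<Rightarrow> bool" where
  "convex_body K \<longleftrightarrow> compact K \<and> convex K \<and> interior K \<noteq> {}"

definition support_hyperplane :: "'a::euclidean_space set \<Rightarrow> 'a set \<Rightarrow> bool" where
  "support_hyperplane K H \<longleftrightarrow>
     (\<exists>u c. u \<noteq> 0 \<and> H = {x. u \<bullet> x = c} \<and> K \<inter> H \<noteq> {} \<and> K \<subseteq> {x. u \<bullet> x \<le> c})"

definition parallel_hyperplanes :: "'a::euclidean_space set \<Rightarrow> 'a set \<Rightarrow> bool" where
  "parallel_hyperplanes H H' \<longleftrightarrow>
     (\<exists>u a b. u \<noteq> 0 \<and> H = {x. u \<bullet> x = a} \<and> H' = {x. u \<bullet> x = b})"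

(* A hyperplane is parallel to itself in the above sense, so the two support hyperplanes
   have to be required to be distinct; otherwise the minimal distance would be 0. *)
definition min_width :: "'a::euclidean_space set \<Rightarrow> real" where
  "min_width K =
     Inf {setdist H H' | H H'. support_hyperplane K H \<and> support_hyperplane K H' \<and>
            H \<noteq> H' \<and> parallel_hyperplanes H H'}"

(* One-dimensional Hausdorff (outer) measure, normalised so that a segment has its length as
   measure. Boundedness of the covering sets is explicit because the diameter of an unbounded
   set is 0 in the library; empty covering sets are allowed, so finite covers are included. *)
definition hausdorff1_pre :: "real \<Rightarrow> 'a::metric_space set \<Rightarrow> ennreal" where
  "hausdorff1_pre \<delta> A =
     (INF C \<in> {C :: nat \<Rightarrow> 'a set. A \<subseteq> (\<Union>i. C i) \<and> (\<forall>i. bounded (C i) \<and> diameter (C i) \<le> \<delta>)}.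
        (\<Sum>i. ennreal (diameter (C i))))"

definition hausdorff1 :: "'a::metric_space set \<Rightarrow> ennreal" where
  "hausdorff1 A = (SUP \<delta>\<in>{0<..}. hausdorff1_pre \<delta> A)"

definition open_nbhd :: "real \<Rightarrow> 'a::metric_space set \<Rightarrow> 'a set" where
  "open_nbhd t Z = {x. \<exists>z\<in>Z. dist x z < t}"

(* The index m is the dimension of the content; only m \<le> DIM('a) is meaningful. *)
definition lower_minkowski_content :: "nat \<Rightarrow> 'a::euclidean_space set \<Rightarrow> ennreal" where
  "lower_minkowski_content m Z =
     Liminf (at_right 0)
       (\<lambda>t. emeasure lborel (open_nbhd t Z) /
            ennreal (unit_ball_vol (real (DIM('a) - m)) * t ^ (DIM('a) - m)))"

(* R^k is the library's topology Euclidean_space k, whose points are the functions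
   nat \<Rightarrow> real vanishing at all indices i \<ge> k. In contrast to the types of class
   euclidean_space this includes k = 0. *)
definition continuous_maps_to :: "'a::euclidean_space set \<Rightarrow> nat \<Rightarrow> ('a \<Rightarrow> nat \<Rightarrow> real) set" where
  "continuous_maps_to X k = {f. continuous_map (top_of_set X) (Euclidean_space k) f}"

definition fiber :: "'a set \<Rightarrow> ('a \<Rightarrow> 'b) \<Rightarrow> 'b \<Rightarrow> 'a set" where
  "fiber X f y = {x \<in> X. f x = y}"

(* gamma_m X, i.e. gamma_(n-k) X with n = DIM('a) and k = n - m, for m \<le> n. *)
definition minkowski_waist :: "nat \<Rightarrow> 'a::euclidean_space set \<Rightarrow> ennreal" where
  "minkowski_waist m X =
     (INF f \<in> continuous_maps_to X (DIM('a) - m).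
        SUP y \<in> topspace (Euclidean_space (DIM('a) - m)). lower_minkowski_content m (fiber X f y))"

end

theory Submission
  imports Defs "HOL-Real_Asymp.Real_Asymp"
begin

text \<open>
Write \<open>w\<close> for the minimal width of \<open>K\<close> and \<open>n\<close> for the dimension.  The upper bound is easy: if
\<open>K\<close> lies in a slab of width \<open>w + \<epsilon>\<close> with unit normal \<open>u\<close>, then every fibre of the orthogonal projection
along \<open>u\<close> is contained in a segment of length \<open>w + \<epsilon>\<close> (\<open>projection_with_short_fibers\<close>).

The lower bound uses three properties that one-dimensional Hausdorff measure and the
lower Minkowski content have in common (\<open>length_content\<close>): monotonicity, superadditivity on disjoint
compact sets, and the fact that a continuum has at least the content of the distance of any two of
its points.  Suppose that all fibres of a map \<open>f\<close> from \<open>K\<close> to \<open>(n-1)\<close>-space have content less than \<open>w\<close>.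

The metric half of the argument shows that a continuum \<open>X\<close> of content less than \<open>w\<close> can be translated into the
interior of \<open>K\<close> (\<open>short_continuum_translates_into_interior\<close>).  Every vector of length at most \<open>w\<close>
is a difference of two points of \<open>K\<close>; hence a pair of points at distance \<open>d\<close> can be translated into
\<open>(d/w) K\<close>.  If \<open>A\<close> and \<open>B\<close> have a point in common and can be translated into \<open>rK\<close> and \<open>sK\<close>, then
\<open>A \<union> B\<close> can be translated into \<open>rK + sK = (r + s)K\<close>.  Thus a finite tree with straight edges of total
length \<open>l\<close> can be translated into \<open>(l/w) K\<close>.  Now \<open>X\<close> is path connected because its content is finite, and any finite
subset of \<open>X\<close> is joined by arcs in \<open>X\<close> that form a tree; polygons inscribed in these arcs have total length at most the
content of \<open>X\<close>.  By compactness all of \<open>X\<close> can be translated into a copy of \<open>K\<close> scaled by a factor less than \<open>1\<close>.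

The topological half is a dimension argument.  Each component of a fibre can be translated into the interior,
hence so can each piece of a suitable finite clopen partition of the fibre, and the same translations serve a
neighbourhood.  A covering of \<open>(n-1)\<close>-space by small cubes of multiplicity at most \<open>n\<close> and a partition of
unity combine these translations into a continuous displacement \<open>q\<close> with \<open>x + q x\<close> in the
interior of \<open>K\<close> for all \<open>x \<in> K\<close>.  By Brouwer's fixed point theorem the values of \<open>q\<close> fill
a ball around \<open>0\<close>.  On the other hand \<open>q x\<close> is always a convex combination of at most \<open>n\<close> points out of
a fixed finite set, so its values form a null set: a contradiction (\<open>weighted_translations_small_multiplicity\<close>).
\<close>

section \<open>Width, chords and translates into scaled copies\<close>

lemma min_width_set_bdd_below:
  "bdd_below {setdist H H' | H H'. support_hyperplane K H \<and> support_hyperplane K H' \<and>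
            H \<noteq> H' \<and> parallel_hyperplanes H H'}"
  by (rule bdd_belowI[of _ 0]) (auto simp: setdist_pos_le)

lemma extreme_points_in_direction:
  fixes K :: "'a::euclidean_space set"
  assumes "convex_body K"
  obtains p q where "p \<in> K" "q \<in> K" "\<And>x. x \<in> K \<Longrightarrow> u \<bullet> p \<le> u \<bullet> x" "\<And>x. x \<in> K \<Longrightarrow> u \<bullet> x \<le> u \<bullet> q"
proof -
  have K: "compact K" "K \<noteq> {}"
    using assms interior_subset by (auto simp: convex_body_def)
  have c: "continuous_on K (\<lambda>x. u \<bullet> x)"
    by (intro continuous_intros)
  show thesis
    using continuous_attains_inf[OF K c] continuous_attains_sup[OF K c] that by metis
qed

text \<open>
In the direction \<open>u\<close> the two support hyperplanes are distinct because \<open>K\<close> has interior points, so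
every direction contributes to the infimum that defines the minimal width.
\<close>

lemma width_candidate:
  fixes K :: "'a::euclidean_space set"
  assumes K: "convex_body K" and u: "norm u = 1" and pq: "p \<in> K" "q \<in> K"
    and p: "\<And>x. x \<in> K \<Longrightarrow> u \<bullet> p \<le> u \<bullet> x" and q: "\<And>x. x \<in> K \<Longrightarrow> u \<bullet> x \<le> u \<bullet> q"
  obtains H H' where "support_hyperplane K H" "support_hyperplane K H'" "H \<noteq> H'"
    "parallel_hyperplanes H H'" "setdist H H' \<le> u \<bullet> q - u \<bullet> p"
proof -
  have u0: "u \<noteq> 0" and uu: "u \<bullet> u = 1"
    using u by (auto simp: norm_eq_1)
  have ne: "u \<bullet> p \<noteq> u \<bullet> q"
  proof
    assume "u \<bullet> p = u \<bullet> q"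
    then have "K \<subseteq> {x. u \<bullet> x = u \<bullet> q}"
      using p q by force
    then have "interior K \<subseteq> interior {x. u \<bullet> x = u \<bullet> q}"
      by (rule interior_mono)
    then show False
      using K u0 by (simp add: convex_body_def)
  qed
  let ?H = "{x. u \<bullet> x = u \<bullet> q}" and ?H' = "{x. u \<bullet> x = u \<bullet> p}"
  have 1: "support_hyperplane K ?H"
    unfolding support_hyperplane_def
    by (rule exI[of _ u], rule exI[of _ "u \<bullet> q"]) (use u0 pq q in auto)
  have 2: "support_hyperplane K ?H'"
    unfolding support_hyperplane_def
    by (rule exI[of _ "-u"], rule exI[of _ "-(u \<bullet> p)"]) (use u0 pq p in auto)
  have 3: "?H \<noteq> ?H'"
    using ne by auto
  have 4: "parallel_hyperplanes ?H ?H'"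
    unfolding parallel_hyperplanes_def using u0 by blast
  let ?d = "u \<bullet> q - u \<bullet> p"
  have "setdist ?H ?H' \<le> dist q (q - ?d *\<^sub>R u)"
    by (rule setdist_le_dist) (auto simp: inner_diff_right uu)
  also have "\<dots> = ?d"
    using p[OF pq(2)] u by (simp add: dist_norm)
  finally show thesis
    using that 1 2 3 4 by blast
qed

lemma min_width_le_width:
  fixes K :: "'a::euclidean_space set"
  assumes K: "convex_body K" and u: "norm u = 1" and pq: "p \<in> K" "q \<in> K"
    and p: "\<And>x. x \<in> K \<Longrightarrow> u \<bullet> p \<le> u \<bullet> x" and q: "\<And>x. x \<in> K \<Longrightarrow> u \<bullet> x \<le> u \<bullet> q"
  shows "min_width K \<le> u \<bullet> q - u \<bullet> p"
proof -
  obtain H H' where H: "support_hyperplane K H" "support_hyperplane K H'" "H \<noteq> H'"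
    "parallel_hyperplanes H H'" "setdist H H' \<le> u \<bullet> q - u \<bullet> p"
    using width_candidate[OF assms] by blast
  then have "min_width K \<le> setdist H H'"
    unfolding min_width_def by (intro cInf_lower min_width_set_bdd_below) blast
  with H(5) show ?thesis by simp
qed

text \<open>
The definition of a support hyperplane provides some normal \<open>v\<close>, unrelated to the given \<open>u\<close>.  If \<open>K\<close> had points
on both sides with respect to \<open>u\<close>, the segment between them would cross the hyperplane
at a point where \<open>v\<close> is both maximal and strictly below its maximum.
\<close>

lemma support_hyperplane_one_sided:
  fixes K :: "'a::euclidean_space set"
  assumes "convex K" and H: "support_hyperplane K {x. u \<bullet> x = a}"
  shows "(\<forall>x\<in>K. u \<bullet> x \<le> a) \<or> (\<forall>x\<in>K. a \<le> u \<bullet> x)"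
proof (rule ccontr)
  assume "\<not> ?thesis"
  then obtain x y where xy: "x \<in> K" "y \<in> K" "u \<bullet> x > a" "u \<bullet> y < a"
    by force
  obtain v c where v: "{x. u \<bullet> x = a} = {x. v \<bullet> x = c}" "K \<subseteq> {x. v \<bullet> x \<le> c}"
    using H unfolding support_hyperplane_def by metis
  have vx: "v \<bullet> x < c" "v \<bullet> y < c"
    using xy v by force+
  define t where "t = (u \<bullet> x - a) / (u \<bullet> x - u \<bullet> y)"
  have t: "0 \<le> t" "t \<le> 1"
    using xy by (auto simp: t_def field_simps)
  let ?z = "(1 - t) *\<^sub>R x + t *\<^sub>R y"
  have "u \<bullet> ?z = u \<bullet> x - t * (u \<bullet> x - u \<bullet> y)"
    by (simp add: inner_add_right algebra_simps)
  also have "\<dots> = a"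
    using xy by (simp add: t_def)
  finally have "v \<bullet> ?z = c"
    using v(1) by blast
  moreover have "v \<bullet> ?z < c"
    using convex_bound_lt[OF vx, of "1 - t" t] t by (simp add: inner_add_right)
  ultimately show False by simp
qed

text \<open>
Two parallel support hyperplanes of almost minimal distance enclose \<open>K\<close>.
\<close>

lemma thin_slab:
  fixes K :: "'a::euclidean_space set"
  assumes K: "convex_body K" and e: "e > 0"
  obtains u where "norm u = 1" "\<And>x y. x \<in> K \<Longrightarrow> y \<in> K \<Longrightarrow> u \<bullet> (y - x) \<le> min_width K + e"
proof -
  let ?W = "{setdist H H' | H H'. support_hyperplane K H \<and> support_hyperplane K H' \<and>
            H \<noteq> H' \<and> parallel_hyperplanes H H'}"
  obtain b :: 'a where b: "b \<in> Basis"
    using nonempty_Basis by blast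
  obtain p q where pq: "p \<in> K" "q \<in> K" "\<And>x. x \<in> K \<Longrightarrow> b \<bullet> p \<le> b \<bullet> x" "\<And>x. x \<in> K \<Longrightarrow> b \<bullet> x \<le> b \<bullet> q"
    using extreme_points_in_direction[OF K] by metis
  obtain H0 H1 where "support_hyperplane K H0" "support_hyperplane K H1" "H0 \<noteq> H1"
    "parallel_hyperplanes H0 H1"
    using width_candidate[OF K norm_Basis[OF b] pq] by metis
  then have "?W \<noteq> {}"
    by blast
  moreover have "Inf ?W < min_width K + e"
    using e by (simp add: min_width_def)
  ultimately obtain d where "d \<in> ?W" and d: "d < min_width K + e"
    using cInf_lessD by meson
  then obtain H H' where H: "d = setdist H H'" "support_hyperplane K H" "support_hyperplane K H'"
    "H \<noteq> H'" "parallel_hyperplanes H H'"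
    by blast
  obtain u a b where u: "u \<noteq> 0" "H = {x. u \<bullet> x = a}" "H' = {x. u \<bullet> x = b}"
    using H(5) unfolding parallel_hyperplanes_def by blast
  have "convex K"
    using K by (simp add: convex_body_def)
  note side = support_hyperplane_one_sided[OF this]
  obtain x0 y0 where x0: "x0 \<in> K" "u \<bullet> x0 = a" "y0 \<in> K" "u \<bullet> y0 = b"
    using H(2,3) u(2,3) unfolding support_hyperplane_def by blast
  have "a \<noteq> b"
    using H(4) u by auto
  have slab: "u \<bullet> (y - x) \<le> \<bar>a - b\<bar>" if xy: "x \<in> K" "y \<in> K" for x y
  proof -
    have "(u \<bullet> x \<le> a \<and> u \<bullet> y \<le> a \<and> b \<le> a) \<or> (a \<le> u \<bullet> x \<and> a \<le> u \<bullet> y \<and> a \<le> b)"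
      using side[of u a] H(2) u(2) x0 xy by blast
    moreover have "(u \<bullet> x \<le> b \<and> u \<bullet> y \<le> b \<and> a \<le> b) \<or> (b \<le> u \<bullet> x \<and> b \<le> u \<bullet> y \<and> b \<le> a)"
      using side[of u b] H(3) u(3) x0 xy by blast
    ultimately show ?thesis
      using \<open>a \<noteq> b\<close> by (auto simp: inner_diff_right)
  qed
  have "\<bar>a - b\<bar> / norm u \<le> setdist H H'"
  proof (rule le_setdistI)
    show "H \<noteq> {}" "H' \<noteq> {}"
      using x0 u by auto
    fix x y assume "x \<in> H" "y \<in> H'"
    then have "\<bar>a - b\<bar> = \<bar>u \<bullet> (x - y)\<bar>"
      using u by (simp add: inner_diff_right)
    also have "\<dots> \<le> norm u * dist x y"
      unfolding dist_norm by (rule Cauchy_Schwarz_ineq2)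
    finally show "\<bar>a - b\<bar> / norm u \<le> dist x y"
      using u by (simp add: field_simps)
  qed
  then have n: "\<bar>a - b\<bar> / norm u \<le> min_width K + e"
    using d H(1) by simp
  show thesis
  proof (rule that[of "u /\<^sub>R norm u"])
    show "norm (u /\<^sub>R norm u) = 1"
      using u by simp
    fix x y assume "x \<in> K" "y \<in> K"
    then have "(u \<bullet> (y - x)) / norm u \<le> \<bar>a - b\<bar> / norm u"
      using slab by (intro divide_right_mono) auto
    with n show "(u /\<^sub>R norm u) \<bullet> (y - x) \<le> min_width K + e"
      by (simp add: divide_inverse mult.commute)
  qed
qed

lemma min_width_pos:
  fixes K :: "'a::euclidean_space set"
  assumes K: "convex_body K"
  shows "0 < min_width K"
proof -
  obtain z r where r: "r > 0" "cball z r \<subseteq> K"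
    using K unfolding convex_body_def by (metis ex_in_conv mem_interior_cball)
  have "r \<le> min_width K"
  proof (rule field_le_epsilon)
    fix e :: real assume "e > 0"
    then obtain u where u: "norm u = 1" "\<And>x y. x \<in> K \<Longrightarrow> y \<in> K \<Longrightarrow> u \<bullet> (y - x) \<le> min_width K + e"
      using thin_slab[OF K] by metis
    have "z \<in> K" "z + r *\<^sub>R u \<in> K"
      using r u(1) by (auto intro!: subsetD[OF r(2)] simp: dist_norm)
    from u(2)[OF this] show "r \<le> min_width K + e"
      using u(1) by (simp add: norm_eq_1)
  qed
  with r show ?thesis by simp
qed

text \<open>
The difference set \<open>K - K\<close> is compact, convex and symmetric with support function the width of \<open>K\<close>.  A vector
outside of it is separated from it by a direction in which \<open>K\<close> has width less than the length of the vector.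
\<close>

lemma short_vector_is_chord:
  fixes K :: "'a::euclidean_space set"
  assumes K: "convex_body K" and a: "norm a \<le> min_width K"
  obtains x y where "x \<in> K" "y \<in> K" "y - x = a"
proof (rule ccontr)
  assume neg: "\<not> thesis"
  define D where "D = (\<Union>x\<in>K. \<Union>y\<in>K. {x - y})"
  have K': "compact K" "convex K"
    using K by (auto simp: convex_body_def)
  have memD: "y - x \<in> D" if "y \<in> K" "x \<in> K" for x y
    using that by (auto simp: D_def)
  have "D = {x - y |x y. x \<in> K \<and> y \<in> K}"
    by (auto simp: D_def)
  then have D: "closed D" "convex D"
    using compact_differences[OF K'(1) K'(1)] convex_differences[OF K'(2) K'(2)]
    by (simp_all add: compact_imp_closed flip: D_def)
  have "a \<notin> D"
    using neg that by (auto simp: D_def)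
  then obtain v b where v: "v \<bullet> a < b" "\<And>x. x \<in> D \<Longrightarrow> v \<bullet> x > b"
    using separating_hyperplane_closed_point[OF D(2,1)] by metis
  have v0: "v \<noteq> 0"
  proof
    assume "v = 0"
    obtain k where "k \<in> K"
      using K interior_subset by (auto simp: convex_body_def)
    then have "b < v \<bullet> (k - k)"
      by (intro v(2) memD)
    with v(1) \<open>v = 0\<close> show False
      by simp
  qed
  define u where "u = - v /\<^sub>R norm v"
  have u: "norm u = 1"
    using v0 by (simp add: u_def)
  obtain p q where pq: "p \<in> K" "q \<in> K" "\<And>x. x \<in> K \<Longrightarrow> u \<bullet> p \<le> u \<bullet> x" "\<And>x. x \<in> K \<Longrightarrow> u \<bullet> x \<le> u \<bullet> q"
    using extreme_points_in_direction[OF K] by metis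
  have "v \<bullet> a < v \<bullet> (q - p)"
    using v(1) v(2)[OF memD[OF pq(2,1)]] by linarith
  then have "u \<bullet> (q - p) < u \<bullet> a"
    using v0 by (simp add: u_def)
  also have "\<dots> \<le> norm a"
    using norm_cauchy_schwarz[of u a] u by simp
  finally show False
    using a min_width_le_width[OF K u pq] by (simp add: inner_diff_right)
qed

definition fits :: "'a::real_vector set \<Rightarrow> 'a set \<Rightarrow> real \<Rightarrow> bool" where
  "fits K S r \<longleftrightarrow> (\<exists>v. \<forall>x\<in>S. x - v \<in> (*\<^sub>R) r ` K)"

lemma fits_subset: "fits K T r \<Longrightarrow> S \<subseteq> T \<Longrightarrow> fits K S r"
  unfolding fits_def by blast

lemma convex_scaled_sum:
  assumes "convex K" "0 \<le> r" "0 \<le> s" "a \<in> (*\<^sub>R) r ` K" "b \<in> (*\<^sub>R) s ` K"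
  shows "a + b \<in> (*\<^sub>R) (r + s) ` K"
proof -
  obtain k l where k: "k \<in> K" "l \<in> K" "a = r *\<^sub>R k" "b = s *\<^sub>R l"
    using assms by blast
  show ?thesis
  proof (cases "r + s = 0")
    case True
    then have "r = 0" "s = 0" using assms by auto
    then show ?thesis using k by auto
  next
    case False
    then have rs: "r + s > 0" using assms by linarith
    let ?m = "(r / (r + s)) *\<^sub>R k + (s / (r + s)) *\<^sub>R l"
    have "?m \<in> K"
      using rs assms k by (intro convexD) (auto simp: add_divide_distrib[symmetric])
    moreover have "a + b = (r + s) *\<^sub>R ?m"
      using rs k by (simp add: scaleR_add_right)
    ultimately show ?thesis by blast
  qed
qed

text \<open>
If \<open>S - v\<close> and \<open>T - w\<close> lie in \<open>rK\<close> and \<open>sK\<close>, then a translation by \<open>v + w - c\<close> works for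
the union: for \<open>x\<close> in \<open>S\<close> one has \<open>x - (v + w - c) = (x - v) + (c - w)\<close>, and symmetrically for \<open>T\<close>.
\<close>

lemma fits_Un:
  assumes "convex K" "0 \<le> r" "0 \<le> s" "fits K S r" "fits K T s" "c \<in> S" "c \<in> T"
  shows "fits K (S \<union> T) (r + s)"
proof -
  obtain v w where v: "\<And>x. x \<in> S \<Longrightarrow> x - v \<in> (*\<^sub>R) r ` K" and w: "\<And>x. x \<in> T \<Longrightarrow> x - w \<in> (*\<^sub>R) s ` K"
    using assms unfolding fits_def by blast
  have "x - (v + w - c) \<in> (*\<^sub>R) (r + s) ` K" if "x \<in> S \<union> T" for x
  proof -
    consider "x \<in> S" | "x \<in> T" using \<open>x \<in> S \<union> T\<close> by blast
    then show ?thesis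
    proof cases
      case 1
      then show ?thesis
        using convex_scaled_sum[OF assms(1-3) v[OF 1] w[OF assms(7)]] by (simp add: algebra_simps)
    next
      case 2
      then show ?thesis
        using convex_scaled_sum[OF assms(1-3) v[OF assms(6)] w[OF 2]] by (simp add: algebra_simps)
    qed
  qed
  then show ?thesis
    unfolding fits_def by blast
qed

lemma fits_singleton:
  assumes "K \<noteq> {}"
  shows "fits K {x} r"
proof -
  obtain k where "k \<in> K" using assms by blast
  then show ?thesis
    unfolding fits_def by (intro exI[of _ "x - r *\<^sub>R k"]) auto
qed

lemma fits_mono:
  assumes "convex K" "K \<noteq> {}" "0 \<le> r" "r \<le> s" "fits K S r"
  shows "fits K S s"
proof (cases "S = {}")
  case True
  then show ?thesis by (simp add: fits_def)
next
  case False
  then obtain c where c: "c \<in> S" by blast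
  then have "fits K (S \<union> {c}) (r + (s - r))"
    using assms by (intro fits_Un[where c = c]) (auto simp: fits_singleton)
  with c show ?thesis
    by (simp add: insert_absorb)
qed

lemma fits_pair:
  fixes K :: "'a::euclidean_space set"
  assumes K: "convex_body K"
  shows "fits K {x, y} (dist x y / min_width K)"
proof (cases "x = y")
  case True
  have "K \<noteq> {}"
    using K interior_subset by (auto simp: convex_body_def)
  then show ?thesis
    using True fits_singleton by auto
next
  case False
  note w = min_width_pos[OF K]
  define r where "r = dist x y / min_width K"
  have r: "r > 0"
    using w False by (simp add: r_def)
  have "norm ((y - x) /\<^sub>R r) \<le> min_width K"
    using w False by (simp add: r_def dist_norm norm_minus_commute)
  then obtain k l where kl: "k \<in> K" "l \<in> K" "l - k = (y - x) /\<^sub>R r"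
    using short_vector_is_chord[OF K] by blast
  have "y - x = r *\<^sub>R (l - k)"
    using kl(3) r by simp
  then have "y = x + r *\<^sub>R (l - k)"
    by (simp add: algebra_simps)
  then have "y - (x - r *\<^sub>R k) = r *\<^sub>R l" "x - (x - r *\<^sub>R k) = r *\<^sub>R k"
    by (auto simp: algebra_simps)
  then have "\<forall>z\<in>{x,y}. z - (x - r *\<^sub>R k) \<in> (*\<^sub>R) r ` K"
    using kl by auto
  then show ?thesis
    unfolding fits_def r_def by blast
qed

text \<open>
The admissible translation vectors of a single point form a compact set, so the finite intersection property applies.
\<close>

lemma fits_of_finite_subsets:
  fixes K :: "'a::euclidean_space set"
  assumes K: "compact K" and fin: "\<And>F. finite F \<Longrightarrow> F \<subseteq> S \<Longrightarrow> fits K F r"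
  shows "fits K S r"
proof (cases "S = {}")
  case True
  then show ?thesis by (simp add: fits_def)
next
  case False
  then obtain c where c: "c \<in> S" by blast
  define V where "V x = (\<lambda>k. x - r *\<^sub>R k) ` K" for x
  have V: "v \<in> V x \<longleftrightarrow> x - v \<in> (*\<^sub>R) r ` K" for v x
  proof -
    have "v = x - r *\<^sub>R k \<longleftrightarrow> x - v = r *\<^sub>R k" for k
      by (auto simp: algebra_simps)
    then show ?thesis
      unfolding V_def image_iff by auto
  qed
  have comp: "compact (V x)" for x
    unfolding V_def by (intro compact_continuous_image K continuous_intros)
  have "V c \<inter> (\<Inter>x\<in>S. V x) \<noteq> {}"
  proof (rule compact_imp_fip_image[OF comp])
    show "closed (V x)" for x
      by (rule compact_imp_closed[OF comp])
    fix F assume F: "finite F" "F \<subseteq> S"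
    then have "fits K (insert c F) r"
      using c by (intro fin) auto
    then obtain v where "\<forall>x\<in>insert c F. x - v \<in> (*\<^sub>R) r ` K"
      unfolding fits_def by blast
    then have "v \<in> V c \<inter> (\<Inter>x\<in>F. V x)"
      using V by blast
    then show "V c \<inter> \<Inter> (V ` F) \<noteq> {}"
      by blast
  qed
  then show ?thesis
    using V unfolding fits_def by blast
qed

lemma fits_into_interior:
  fixes K :: "'a::euclidean_space set"
  assumes K: "convex_body K" and r: "0 \<le> r" "r < 1" and S: "fits K S r"
  obtains v where "\<And>x. x \<in> S \<Longrightarrow> x + v \<in> interior K"
proof -
  obtain p where p: "p \<in> interior K"
    using K by (auto simp: convex_body_def)
  have K': "convex K" "compact K"
    using K by (auto simp: convex_body_def)
  obtain v where v: "\<And>x. x \<in> S \<Longrightarrow> x - v \<in> (*\<^sub>R) r ` K"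
    using S unfolding fits_def by blast
  show thesis
  proof (rule that[of "(1 - r) *\<^sub>R p - v"])
    fix x assume "x \<in> S"
    then obtain k where k: "k \<in> K" "x - v = r *\<^sub>R k"
      using v by blast
    have "k - (1 - r) *\<^sub>R (k - p) \<in> interior K"
      by (rule mem_interior_convex_shrink) (use K' p k r in auto)
    moreover have "k - (1 - r) *\<^sub>R (k - p) = x + ((1 - r) *\<^sub>R p - v)"
      using k(2) by (simp add: algebra_simps)
    ultimately show "x + ((1 - r) *\<^sub>R p - v) \<in> interior K"
      by simp
  qed
qed

section \<open>Continua of small length content\<close>

text \<open>
The properties shared by one-dimensional Hausdorff measure and the lower Minkowski content on which the lower
bound rests.  Disjoint compact sets have positive distance, which is why superadditivity is stated for them.
\<close>

definition length_content :: "('a::euclidean_space set \<Rightarrow> ennreal) \<Rightarrow> bool" where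
  "length_content \<nu> \<longleftrightarrow>
     (\<forall>A B. A \<subseteq> B \<longrightarrow> \<nu> A \<le> \<nu> B) \<and>
     (\<forall>C p q. compact C \<longrightarrow> connected C \<longrightarrow> p \<in> C \<longrightarrow> q \<in> C \<longrightarrow> ennreal (dist p q) \<le> \<nu> C) \<and>
     (\<forall>A B. compact A \<longrightarrow> compact B \<longrightarrow> A \<inter> B = {} \<longrightarrow> \<nu> A + \<nu> B \<le> \<nu> (A \<union> B))"

lemma
  assumes "length_content \<nu>"
  shows length_content_mono: "A \<subseteq> B \<Longrightarrow> \<nu> A \<le> \<nu> B"
    and length_content_connected:
      "compact C \<Longrightarrow> connected C \<Longrightarrow> p \<in> C \<Longrightarrow> q \<in> C \<Longrightarrow> ennreal (dist p q) \<le> \<nu> C"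
    and length_content_disjoint:
      "compact A \<Longrightarrow> compact B \<Longrightarrow> A \<inter> B = {} \<Longrightarrow> \<nu> A + \<nu> B \<le> \<nu> (A \<union> B)"
  using assms unfolding length_content_def by simp_all

text \<open>
Compact subsets of disjoint sets are disjoint compact sets.  Therefore the inner content is superadditive on
arbitrary disjoint sets, in particular on the half-open arcs into which trees are cut.
\<close>

definition inner_content :: "('a::topological_space set \<Rightarrow> ennreal) \<Rightarrow> 'a set \<Rightarrow> ennreal" where
  "inner_content \<nu> T = (SUP C\<in>{C. compact C \<and> C \<subseteq> T}. \<nu> C)"

lemma inner_content_upper: "compact C \<Longrightarrow> C \<subseteq> T \<Longrightarrow> \<nu> C \<le> inner_content \<nu> T"
  unfolding inner_content_def by (rule SUP_upper) auto

lemma inner_content_le: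
  assumes "length_content \<nu>" "T \<subseteq> X"
  shows "inner_content \<nu> T \<le> \<nu> X"
  unfolding inner_content_def
  by (rule SUP_least) (use length_content_mono[OF assms(1)] assms(2) in blast)

lemma inner_content_superadditive:
  assumes "length_content \<nu>" "S \<inter> T = {}"
  shows "inner_content \<nu> S + inner_content \<nu> T \<le> inner_content \<nu> (S \<union> T)"
proof -
  have ne: "{C. compact C \<and> C \<subseteq> S} \<noteq> {}" "{C. compact C \<and> C \<subseteq> T} \<noteq> {}"
    by (auto intro: exI[of _ "{}"])
  have "\<nu> A + inner_content \<nu> T \<le> inner_content \<nu> (S \<union> T)" if A: "compact A" "A \<subseteq> S" for A
    unfolding inner_content_def[of \<nu> T] ennreal_SUP_add_right[OF ne(2)]
  proof (rule SUP_least)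
    fix B assume B: "B \<in> {C. compact C \<and> C \<subseteq> T}"
    then have "\<nu> A + \<nu> B \<le> \<nu> (A \<union> B)"
      using A assms(2) by (intro length_content_disjoint[OF assms(1)]) auto
    also have "\<dots> \<le> inner_content \<nu> (S \<union> T)"
      using A B by (intro inner_content_upper compact_Un) auto
    finally show "\<nu> A + \<nu> B \<le> inner_content \<nu> (S \<union> T)" .
  qed
  then show ?thesis
    unfolding inner_content_def[of \<nu> S] ennreal_SUP_add_left[OF ne(1), symmetric]
    by (intro SUP_least) auto
qed

text \<open>
The subarcs on \<open>[c, b]\<close> with \<open>c > a\<close> are continua, and their chords converge to the whole chord as \<open>c\<close> tends to \<open>a\<close>.
\<close>

lemma inner_content_half_open_arc:
  fixes g :: "real \<Rightarrow> 'a::euclidean_space"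
  assumes \<nu>: "length_content \<nu>" and g: "continuous_on {a..b} g" and ab: "a < b"
  shows "ennreal (dist (g a) (g b)) \<le> inner_content \<nu> (g ` {a<..b})"
proof (rule tendsto_upperbound)
  have "(g \<longlongrightarrow> g a) (at a within {a..b})"
    using g ab by (simp add: continuous_on_def)
  then have "(g \<longlongrightarrow> g a) (at_right a)"
    using ab by (simp add: at_within_Icc_at_right)
  then show "((\<lambda>c. ennreal (dist (g c) (g b))) \<longlongrightarrow> ennreal (dist (g a) (g b))) (at_right a)"
    by (intro tendsto_intros)
  show "\<forall>\<^sub>F c in at_right a. ennreal (dist (g c) (g b)) \<le> inner_content \<nu> (g ` {a<..b})"
    unfolding eventually_at_right[OF ab]
  proof (intro exI[of _ b] conjI ab allI impI)
    fix c assume c: "a < c" "c < b"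
    have gc: "continuous_on {c..b} g"
      by (rule continuous_on_subset[OF g]) (use c in auto)
    have "ennreal (dist (g c) (g b)) \<le> \<nu> (g ` {c..b})"
      using c by (intro length_content_connected[OF \<nu>] compact_continuous_image
          connected_continuous_image gc) auto
    also have "\<dots> \<le> inner_content \<nu> (g ` {a<..b})"
      using c by (intro inner_content_upper compact_continuous_image gc) auto
    finally show "ennreal (dist (g c) (g b)) \<le> inner_content \<nu> (g ` {a<..b})" .
  qed
qed simp

lemma real_inner_content_superadditive:
  assumes "length_content \<nu>" "S \<inter> T = {}" "S \<union> T \<subseteq> X" "\<nu> X < top"
  shows "enn2real (inner_content \<nu> S) + enn2real (inner_content \<nu> T) \<le> enn2real (inner_content \<nu> (S \<union> T))"
proof -
  have f: "inner_content \<nu> A < top" if "A \<subseteq> X" for A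
    using inner_content_le[OF assms(1) that] assms(4) by (rule le_less_trans)
  have "enn2real (inner_content \<nu> S + inner_content \<nu> T) \<le> enn2real (inner_content \<nu> (S \<union> T))"
    by (intro enn2real_mono inner_content_superadditive f assms)
  then show ?thesis
    using assms(3) f by (simp add: enn2real_plus)
qed

text \<open>
Insert the vertices in increasing order.  Each new edge of the inscribed polygon costs at most the inner
content of the half-open subarc that it spans, and these subarcs are disjoint by injectivity.
\<close>

lemma arc_fits:
  fixes K :: "'a::euclidean_space set" and g :: "real \<Rightarrow> 'a"
  assumes K: "convex_body K" and \<nu>: "length_content \<nu>"
    and g: "continuous_on {a..b} g" "inj_on g {a..b}" and ab: "a \<le> b" and fin: "\<nu> (g ` {a..b}) < top"
    and F: "finite F" "F \<subseteq> {a..b}"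
  shows "fits K (g ` insert a F) (enn2real (inner_content \<nu> (g ` {a<..b})) / min_width K)"
proof -
  note w = min_width_pos[OF K]
  have K': "convex K" "K \<noteq> {}"
    using K interior_subset by (auto simp: convex_body_def)
  define L where "L T = enn2real (inner_content \<nu> T)" for T
  have L0: "0 \<le> L T" for T
    by (simp add: L_def)
  have main: "fits K (g ` insert a F) (L (g ` {a<..Max (insert a F)}) / min_width K)"
    using F
  proof (induction F rule: finite_linorder_max_induct)
    case empty
    then show ?case
      using fits_singleton[OF K'(2)] by simp
  next
    case (insert t A)
    define m where "m = Max (insert a A)"
    have m: "a \<le> m" "m \<in> insert a A" "\<forall>s\<in>A. s \<le> m"
      using insert.hyps Max_in[of "insert a A"] by (auto simp: m_def)
    have tb: "a \<le> t" "t \<le> b"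
      using insert.prems by auto
    have mt: "m \<le> t"
      using m(2) insert.hyps tb by auto
    have Mt: "Max (insert a (insert t A)) = t"
      using insert.hyps tb by (intro Max_eqI) (auto intro: less_imp_le)
    show ?case
    proof (cases "m = t")
      case True
      then have "A = {}" "t = a"
        using m insert.hyps insert.prems by fastforce+
      then show ?thesis
        using fits_singleton[OF K'(2)] by simp
    next
      case False
      then have lt: "m < t" using mt by simp
      have IH: "fits K (g ` insert a A) (L (g ` {a<..m}) / min_width K)"
        using insert.IH insert.prems by (simp add: m_def)
      have "ennreal (dist (g m) (g t)) \<le> inner_content \<nu> (g ` {m<..t})"
        by (rule inner_content_half_open_arc[OF \<nu> continuous_on_subset[OF g(1)] lt])
           (use m tb in auto)
      moreover have "inner_content \<nu> (g ` {m<..t}) \<le> \<nu> (g ` {a..b})"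
        using m tb by (intro inner_content_le[OF \<nu>]) auto
      ultimately have d: "dist (g m) (g t) \<le> L (g ` {m<..t})"
        using fin unfolding L_def by (metis enn2real_ennreal enn2real_mono le_less_trans zero_le_dist)
      have "g ` {a<..m} \<inter> g ` {m<..t} = {}"
        using tb m mt g(2) by (auto simp: inj_on_def) (metis atLeastAtMost_iff less_eq_real_def order_trans not_le)
      then have "L (g ` {a<..m}) + L (g ` {m<..t}) \<le> L (g ` {a<..m} \<union> g ` {m<..t})"
        unfolding L_def using m tb mt
        by (intro real_inner_content_superadditive[OF \<nu>, where X = "g ` {a..b}"] fin) auto
      also have "g ` {a<..m} \<union> g ` {m<..t} = g ` {a<..t}"
        using m lt by (simp add: image_Un[symmetric] ivl_disj_un)
      finally have sup: "L (g ` {a<..m}) + dist (g m) (g t) \<le> L (g ` {a<..t})"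
        using d by simp
      have "fits K (g ` insert a A \<union> {g m, g t}) (L (g ` {a<..m}) / min_width K + dist (g m) (g t) / min_width K)"
        using w m by (intro fits_Un[OF K'(1) _ _ IH fits_pair[OF K], where c = "g m"]) (auto simp: L0)
      then have "fits K (g ` insert a A \<union> {g m, g t}) (L (g ` {a<..t}) / min_width K)"
        by (rule fits_mono[OF K', rotated 2])
          (use sup w in \<open>auto simp: add_divide_distrib[symmetric] L0 intro!: divide_right_mono\<close>)
      then show ?thesis
        unfolding Mt by (rule fits_subset) auto
    qed
  qed
  show ?thesis
  proof (rule fits_mono[OF K' _ _ main])
    show "0 \<le> L (g ` {a<..Max (insert a F)}) / min_width K"
      using w by (simp add: L0)
    have "Max (insert a F) \<le> b"
      using F ab by auto
    then have "inner_content \<nu> (g ` {a<..Max (insert a F)}) \<le> inner_content \<nu> (g ` {a<..b})"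
      unfolding inner_content_def by (intro SUP_subset_mono) force+
    moreover have "inner_content \<nu> (g ` {a<..b}) < top"
      using inner_content_le[OF \<nu>, of "g ` {a<..b}" "g ` {a..b}"] fin by (force intro: le_less_trans)
    ultimately show "L (g ` {a<..Max (insert a F)}) / min_width K \<le> enn2real (inner_content \<nu> (g ` {a<..b})) / min_width K"
      using w unfolding L_def by (intro divide_right_mono enn2real_mono) auto
  qed
qed

text \<open>
The tree \<open>T\<close> grows by one arc for every new point of \<open>S\<close>.  The arc is cut at its last point on \<open>T\<close>, which
makes the added half-open piece disjoint from \<open>T\<close>; the cut point itself is the common point at which the
translates of the two parts are matched.
\<close>

lemma tree_fits:
  fixes K :: "'a::euclidean_space set"
  assumes K: "convex_body K" and \<nu>: "length_content \<nu>"
    and X: "path_connected X" and fin: "\<nu> X < top"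
    and S: "finite S" "S \<noteq> {}" "S \<subseteq> X"
  shows "\<exists>T. compact T \<and> S \<subseteq> T \<and> T \<subseteq> X \<and>
    (\<forall>F. finite F \<longrightarrow> F \<subseteq> T \<longrightarrow> fits K F (enn2real (inner_content \<nu> T) / min_width K))"
  using S
proof (induction S rule: finite_ne_induct)
  case (singleton x)
  have "K \<noteq> {}"
    using K interior_subset by (auto simp: convex_body_def)
  then have "fits K F r" if "F \<subseteq> {x}" for F r
    using fits_subset[OF fits_singleton that] by blast
  then show ?case
    using singleton by (intro exI[of _ "{x}"]) auto
next
  case (insert x S)
  note w = min_width_pos[OF K]
  have K': "convex K" "K \<noteq> {}"
    using K interior_subset by (auto simp: convex_body_def)
  define L where "L T = enn2real (inner_content \<nu> T)" for T
  obtain T where T: "compact T" "S \<subseteq> T" "T \<subseteq> X"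
    "\<And>F. finite F \<Longrightarrow> F \<subseteq> T \<Longrightarrow> fits K F (L T / min_width K)"
    using insert unfolding L_def by auto
  show ?case
  proof (cases "x \<in> T")
    case True
    then show ?thesis
      using T by (intro exI[of _ T]) (auto simp: L_def)
  next
    case False
    obtain y where y: "y \<in> T"
      using T(2) \<open>S \<noteq> {}\<close> by blast
    obtain g where g: "arc g" "path_image g \<subseteq> X" "g 0 = y" "g 1 = x"
    proof -
      have "x \<in> X" "y \<in> X" "y \<noteq> x"
        using insert.prems y T(3) False by auto
      then show ?thesis
        using X that unfolding path_connected_arcwise pathstart_def pathfinish_def by metis
    qed
    have gc: "continuous_on {0..1} g" and gi: "inj_on g {0..1}"
      using g(1) by (auto simp: arc_def path_def)
    \<comment> \<open>The last parameter \<open>s\<close> at which the arc, which starts on \<open>T\<close>, belongs to \<open>T\<close>.\<close>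
    define J where "J = {0..1} \<inter> g -` T"
    have "compact J"
      unfolding J_def compact_eq_bounded_closed
      using continuous_closed_preimage[OF gc closed_atLeastAtMost compact_imp_closed[OF T(1)]]
      by (auto intro: bounded_subset[of "{0..1}"])
    moreover have "0 \<in> J"
      using g y by (auto simp: J_def)
    ultimately obtain s where s: "s \<in> J" "\<And>t. t \<in> J \<Longrightarrow> t \<le> s"
      using compact_attains_sup[of J] by blast
    have s1: "0 \<le> s" "s < 1" "g s \<in> T"
      using s(1) False g(4) by (auto simp: J_def less_le)
    have off: "g t \<notin> T" if "s < t" "t \<le> 1" for t
      using s(2)[of t] that s1 by (auto simp: J_def)
    have gc': "continuous_on {s..1} g" and gi': "inj_on g {s..1}"
      using continuous_on_subset[OF gc] inj_on_subset[OF gi] s1 by auto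
    have gX: "g ` {s..1} \<subseteq> X"
      using g(2) s1 by (auto simp: path_image_def)
    have fing: "\<nu> (g ` {s..1}) < top"
      using length_content_mono[OF \<nu> gX] fin by (rule le_less_trans)
    have eq: "T \<union> g ` {s..1} = T \<union> g ` {s<..1}"
    proof -
      have "{s..1} = insert s {s<..1}"
        using s1 by auto
      then show ?thesis using s1 by auto
    qed
    have sup: "L T + L (g ` {s<..1}) \<le> L (T \<union> g ` {s..1})"
      unfolding eq L_def
      by (rule real_inner_content_superadditive[OF \<nu> _ _ fin]) (use off T(3) gX in auto)
    have L0: "0 \<le> L T" for T
      by (simp add: L_def)
    show ?thesis
    proof (intro exI[of _ "T \<union> g ` {s..1}"] conjI allI impI)
      show "compact (T \<union> g ` {s..1})"
        by (intro compact_Un T(1) compact_continuous_image gc') auto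
      show "insert x S \<subseteq> T \<union> g ` {s..1}"
        using T(2) g(4) s1 by auto
      show "T \<union> g ` {s..1} \<subseteq> X"
        using T(3) gX by auto
      fix F assume F: "finite F" "F \<subseteq> T \<union> g ` {s..1}"
      obtain G where G: "G \<subseteq> {s..1}" "finite G" "F \<inter> g ` {s..1} = g ` G"
        using finite_subset_image[of "F \<inter> g ` {s..1}" g "{s..1}"] F by auto
      have "fits K (insert (g s) (F \<inter> T)) (L T / min_width K)"
        using F s1 by (intro T(4)) auto
      moreover have "fits K (g ` insert s G) (L (g ` {s<..1}) / min_width K)"
        unfolding L_def using s1 G by (intro arc_fits[OF K \<nu> gc' gi' _ fing]) auto
      ultimately have "fits K (insert (g s) (F \<inter> T) \<union> g ` insert s G)
          (L T / min_width K + L (g ` {s<..1}) / min_width K)"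
        using w by (intro fits_Un[OF K'(1), where c = "g s"]) (auto simp: L0)
      then have "fits K (insert (g s) (F \<inter> T) \<union> g ` insert s G) (L (T \<union> g ` {s..1}) / min_width K)"
        by (rule fits_mono[OF K', rotated 2])
          (use sup w in \<open>auto simp: add_divide_distrib[symmetric] L0 intro!: divide_right_mono\<close>)
      then show "fits K F (enn2real (inner_content \<nu> (T \<union> g ` {s..1})) / min_width K)"
        unfolding L_def by (rule fits_subset) (use F G(3) in auto)
    qed
  qed
qed

text \<open>
The component of \<open>z\<close> in the part of a continuum inside a ball reaches the sphere, as soon as the continuum leaves the ball.
\<close>

lemma boundary_bumping:
  fixes X :: "'a::euclidean_space set"
  assumes X: "compact X" "connected X" and z: "z \<in> X" and y: "y \<in> X" "r < dist z y" and r: "0 < r"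
  obtains C q where "compact C" "connected C" "C \<subseteq> X \<inter> cball z r" "z \<in> C" "q \<in> C" "dist z q = r"
proof -
  define Y where "Y = X \<inter> cball z r"
  define C where "C = connected_component_set Y z"
  have zY: "z \<in> Y"
    using z r by (auto simp: Y_def)
  have Y: "compact Y"
    unfolding Y_def by (intro compact_Int_closed X) auto
  have C: "C \<in> components Y"
    using zY by (auto simp: C_def components_def)
  have cC: "compact C" "connected C" "z \<in> C" "C \<subseteq> Y"
    using compact_components[OF Y C] in_components_connected[OF C] in_components_subset[OF C] zY
    by (auto simp: C_def)
  have "\<exists>q\<in>C. dist z q = r"
  proof (rule ccontr)
    assume "\<not> ?thesis"
    then have "C \<subseteq> ball z r"
      using cC(4) by (fastforce simp: Y_def)
    \<comment> \<open>Otherwise \<open>C\<close> has a clopen neighbourhood in \<open>Y\<close> inside the open ball, which is even clopen in \<open>X\<close>.\<close>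
    then obtain D where D: "openin (top_of_set Y) D" "compact D" "C \<subseteq> D" "D \<subseteq> ball z r"
      using Sura_Bura_clopen_subset[OF closed_imp_locally_compact[OF compact_imp_closed[OF Y]] C cC(1) open_ball] by metis
    obtain U where U: "open U" "D = Y \<inter> U"
      using D(1) by (auto simp: openin_open)
    have DX: "D = X \<inter> (U \<inter> ball z r)"
      using U(2) D(4) unfolding Y_def by auto
    have "openin (top_of_set X) D"
      unfolding openin_open by (rule exI[of _ "U \<inter> ball z r"]) (use DX U(1) open_Int[OF _ open_ball] in blast)
    moreover have "closedin (top_of_set X) D"
    proof (rule closed_subset)
      show "D \<subseteq> X" using DX by blast
      show "closed D" by (rule compact_imp_closed[OF D(2)])
    qed
    moreover have "D \<noteq> {}"
      using cC(3) D(3) by auto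
    ultimately have "D = X"
      using X(2) unfolding connected_clopen by blast
    with y D(4) show False
      by auto
  qed
  with cC that show thesis
    by (auto simp: Y_def)
qed

text \<open>
Inside each of the disjoint balls the continuum contains a continuum that runs from the centre to the sphere.
\<close>

lemma ball_packing:
  fixes X :: "'a::euclidean_space set" and r :: real
  assumes \<nu>: "length_content \<nu>" and X: "compact X" "connected X" and r: "0 < r"
    and P: "finite P" "P \<subseteq> X" "pairwise (\<lambda>p q. 2 * r < dist p q) P"
    and far: "\<And>p. p \<in> P \<Longrightarrow> \<exists>y\<in>X. r < dist p y"
  shows "ennreal (card P * r) \<le> \<nu> (X \<inter> (\<Union>p\<in>P. cball p r))"
  using P far
proof (induction P rule: finite_induct)
  case (insert p P)
  have "p \<in> X"
    using insert.prems by auto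
  obtain y where "y \<in> X" "r < dist p y"
    using insert.prems(3) by blast
  obtain C q where C: "compact C" "connected C" "C \<subseteq> X \<inter> cball p r" "p \<in> C" "q \<in> C" "dist p q = r"
    using boundary_bumping[OF X \<open>p \<in> X\<close> \<open>y \<in> X\<close> \<open>r < dist p y\<close> r] by metis
  have "ennreal r \<le> \<nu> C"
    using length_content_connected[OF \<nu> C(1,2,4,5)] C(6) by simp
  also have "\<dots> \<le> \<nu> (X \<inter> cball p r)"
    by (rule length_content_mono[OF \<nu> C(3)])
  finally have 1: "ennreal r \<le> \<nu> (X \<inter> cball p r)" .
  have 2: "ennreal (card P * r) \<le> \<nu> (X \<inter> (\<Union>p\<in>P. cball p r))"
    using insert by (auto simp: pairwise_insert)
  have disj: "cball p r \<inter> (\<Union>p\<in>P. cball p r) = {}"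
  proof -
    have "False" if "s \<in> P" "dist p x \<le> r" "dist s x \<le> r" for s x
    proof -
      have "2 * r < dist p s"
        using insert.prems(2) insert.hyps that(1) by (auto simp: pairwise_insert)
      also have "\<dots> \<le> dist p x + dist s x"
        by (rule dist_triangle2)
      finally show False using that by simp
    qed
    then show ?thesis by auto
  qed
  have "ennreal (card (insert p P) * r) = ennreal r + ennreal (card P * r)"
    using insert.hyps r by (simp add: distrib_right)
  also have "\<dots> \<le> \<nu> (X \<inter> cball p r) + \<nu> (X \<inter> (\<Union>p\<in>P. cball p r))"
    by (intro add_mono 1 2)
  also have "\<dots> \<le> \<nu> (X \<inter> cball p r \<union> X \<inter> (\<Union>p\<in>P. cball p r))"
    using insert.hyps disj
    by (intro length_content_disjoint[OF \<nu>] compact_Int_closed X closed_UN) auto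
  also have "X \<inter> cball p r \<union> X \<inter> (\<Union>p\<in>P. cball p r) = X \<inter> (\<Union>p\<in>insert p P. cball p r)"
    by auto
  finally show ?case .
qed simp

text \<open>
In a chain with the smallest possible number of steps, vertices that are not neighbours are at least \<open>\<delta>\<close> apart.  Balls of
radius \<open>\<delta>/3\<close> around every second vertex are then disjoint, and the packing bound controls the number of steps.
\<close>

lemma short_chain:
  fixes X :: "'a::euclidean_space set"
  assumes \<nu>: "length_content \<nu>" and X: "compact X" "connected X" and fin: "\<nu> X < top"
    and xy: "x \<in> X" "y \<in> X" and \<delta>: "0 < \<delta>" "\<delta> < dist x y"
  obtains n z where "z 0 = x" "z n = y" "\<And>i. i \<le> n \<Longrightarrow> z i \<in> X"
    "\<And>i. i < n \<Longrightarrow> dist (z i) (z (Suc i)) < \<delta>" "real n * \<delta> \<le> 6 * enn2real (\<nu> X)"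
proof -
  define R where "R a b \<longleftrightarrow> a \<in> X \<and> b \<in> X \<and> dist a b < \<delta>" for a b
  have "R\<^sup>*\<^sup>* x y"
  proof (rule connected_equivalence_relation[OF X(2) xy])
    have "symp R"
      by (rule sympI) (simp add: R_def dist_commute)
    then have "symp R\<^sup>*\<^sup>*"
      by (rule symp_rtranclp)
    then show "R\<^sup>*\<^sup>* a b \<Longrightarrow> R\<^sup>*\<^sup>* b a" for a b
      by (rule sympD)
    show "R\<^sup>*\<^sup>* a b \<Longrightarrow> R\<^sup>*\<^sup>* b c \<Longrightarrow> R\<^sup>*\<^sup>* a c" for a b c
      by (rule rtranclp_trans)
    fix a assume a: "a \<in> X"
    show "\<exists>T. openin (top_of_set X) T \<and> a \<in> T \<and> (\<forall>b\<in>T. R\<^sup>*\<^sup>* a b)"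
    proof (intro exI[of _ "X \<inter> ball a \<delta>"] conjI ballI)
      show "openin (top_of_set X) (X \<inter> ball a \<delta>)"
        by (auto simp: openin_open)
      show "a \<in> X \<inter> ball a \<delta>"
        using a \<delta> by simp
      fix b assume "b \<in> X \<inter> ball a \<delta>"
      then have "R a b"
        using a by (auto simp: R_def)
      then show "R\<^sup>*\<^sup>* a b" ..
    qed
  qed
  then obtain n0 where "(R ^^ n0) x y"
    using rtranclp_imp_relpowp by metis
  define n where "n = (LEAST n. (R ^^ n) x y)"
  have n: "(R ^^ n) x y"
    unfolding n_def by (rule LeastI[of _ n0]) fact
  have n_min: "n \<le> m" if "(R ^^ m) x y" for m
    unfolding n_def using that by (rule Least_le)
  obtain z where z: "z 0 = x" "z n = y" "\<And>i. i < n \<Longrightarrow> R (z i) (z (Suc i))"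
    using n unfolding relpowp_fun_conv by blast
  have zX: "z i \<in> X" if "i \<le> n" for i
  proof (cases "i = n")
    case False
    then show ?thesis using z(3)[of i] that by (auto simp: R_def)
  qed (use z xy in auto)
  \<comment> \<open>Two close vertices would allow a shortcut.\<close>
  have far: "\<delta> \<le> dist (z i) (z j)" if ij: "i + 2 \<le> j" "j \<le> n" for i j
  proof (rule ccontr)
    assume "\<not> ?thesis"
    then have "R (z i) (z j)"
      using zX ij by (auto simp: R_def)
    moreover have "(R ^^ i) x (z i)"
      unfolding relpowp_fun_conv by (rule exI[of _ z]) (use z ij in auto)
    moreover have "(R ^^ (n - j)) (z j) y"
      unfolding relpowp_fun_conv by (rule exI[of _ "\<lambda>k. z (j + k)"]) (use z ij in auto)
    ultimately have "(R ^^ (Suc i + (n - j))) x y"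
      by (metis relpowp_Suc_I relpowp_trans)
    then have "n \<le> Suc i + (n - j)"
      by (rule n_min)
    with ij show False by simp
  qed
  \<comment> \<open>Neighbouring vertices may be arbitrarily close, hence only every second one is used.\<close>
  define P where "P = (\<lambda>i. z (2 * i)) ` {..n div 2}"
  have far2: "\<delta> \<le> dist (z (2 * i)) (z (2 * j))" if "i \<le> n div 2" "j \<le> n div 2" "i \<noteq> j" for i j
  proof (cases "i < j")
    case True
    then show ?thesis using that by (intro far) auto
  next
    case False
    then have "\<delta> \<le> dist (z (2 * j)) (z (2 * i))"
      using that by (intro far) auto
    then show ?thesis by (simp add: dist_commute)
  qed
  have "inj_on (\<lambda>i. z (2 * i)) {..n div 2}"
  proof (rule inj_onI, rule ccontr)
    fix i j assume "i \<in> {..n div 2}" "j \<in> {..n div 2}" "z (2 * i) = z (2 * j)" "i \<noteq> j"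
    then show False
      using far2[of i j] \<delta>(1) by auto
  qed
  then have cP: "card P = n div 2 + 1"
    unfolding P_def by (subst card_image) auto
  have "ennreal (card P * (\<delta> / 3)) \<le> \<nu> (X \<inter> (\<Union>p\<in>P. cball p (\<delta> / 3)))"
  proof (rule ball_packing[OF \<nu> X])
    show "0 < \<delta> / 3" using \<delta> by simp
    show "finite P" "P \<subseteq> X"
      using zX by (auto simp: P_def)
    show "pairwise (\<lambda>p q. 2 * (\<delta> / 3) < dist p q) P"
    proof (rule pairwiseI)
      fix p q assume "p \<in> P" "q \<in> P" "p \<noteq> q"
      then obtain i j where ij: "i \<le> n div 2" "j \<le> n div 2" "i \<noteq> j" "p = z (2 * i)" "q = z (2 * j)"
        unfolding P_def by auto
      with far2[of i j] \<delta>(1) show "2 * (\<delta> / 3) < dist p q" by simp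
    qed
    fix p
    have "dist x y \<le> dist p x + dist p y"
      by (rule dist_triangle3)
    then have "\<delta> / 3 < dist p x \<or> \<delta> / 3 < dist p y"
      using \<delta> by arith
    then show "\<exists>y\<in>X. \<delta> / 3 < dist p y"
      using xy by blast
  qed
  also have "\<dots> \<le> \<nu> X"
    by (rule length_content_mono[OF \<nu>]) auto
  finally have "card P * (\<delta> / 3) \<le> enn2real (\<nu> X)"
    using fin \<delta>(1) by (metis enn2real_ennreal enn2real_mono divide_nonneg_nonneg less_imp_le
        mult_nonneg_nonneg of_nat_0_le_iff zero_le_numeral)
  moreover have "real n * \<delta> / 6 \<le> card P * (\<delta> / 3)"
  proof -
    have "n \<le> 2 * card P"
      unfolding cP by simp
    then have "real n \<le> 2 * real (card P)"
      by linarith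
    then have "real n * \<delta> \<le> 2 * real (card P) * \<delta>"
      using \<delta>(1) by (intro mult_right_mono) auto
    then show ?thesis by (simp add: algebra_simps)
  qed
  ultimately have "real n * \<delta> \<le> 6 * enn2real (\<nu> X)"
    by (simp add: algebra_simps)
  with that[OF z(1,2) zX] z(3) show thesis
    by (auto simp: R_def)
qed

lemma chain_dist:
  assumes "\<And>i. i < n \<Longrightarrow> dist (z i) (z (Suc i)) \<le> \<delta>" "i \<le> n" "j \<le> n"
  shows "dist (z i) (z j) \<le> \<bar>real i - real j\<bar> * \<delta>"
proof -
  have *: "dist (z i) (z (i + k)) \<le> real k * \<delta>" if "i + k \<le> n" for i k
    using that
  proof (induction k)
    case (Suc k)
    have "dist (z i) (z (i + Suc k)) \<le> dist (z i) (z (i + k)) + dist (z (i + k)) (z (Suc (i + k)))"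
      using dist_triangle by simp
    also have "\<dots> \<le> real k * \<delta> + \<delta>"
      using Suc assms(1)[of "i + k"] by (intro add_mono) auto
    finally show ?case by (simp add: algebra_simps)
  qed simp
  show ?thesis
  proof (cases "i \<le> j")
    case True
    with *[of i "j - i"] assms show ?thesis by (simp add: of_nat_diff)
  next
    case False
    with *[of j "i - j"] assms show ?thesis by (simp add: of_nat_diff dist_commute)
  qed
qed

text \<open>
A step function that runs through a short chain at constant speed is Lipschitz up to an error \<open>\<delta>\<close>, with a
constant that does not depend on \<open>\<delta>\<close>.
\<close>

lemma approximate_path:
  fixes X :: "'a::euclidean_space set"
  assumes \<nu>: "length_content \<nu>" and X: "compact X" "connected X" and fin: "\<nu> X < top"
    and xy: "x \<in> X" "y \<in> X" and \<delta>: "0 < \<delta>" "\<delta> < dist x y"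
  shows "\<exists>f::real \<Rightarrow> 'a. (\<forall>t. f t \<in> X) \<and> f 0 = x \<and> f 1 = y \<and>
    (\<forall>s\<in>{0..1}. \<forall>t\<in>{0..1}. dist (f s) (f t) \<le> 6 * enn2real (\<nu> X) * \<bar>s - t\<bar> + \<delta>)"
proof -
  obtain n z where z: "z 0 = x" "z n = y" "\<And>i. i \<le> n \<Longrightarrow> z i \<in> X"
    "\<And>i. i < n \<Longrightarrow> dist (z i) (z (Suc i)) < \<delta>" and n: "real n * \<delta> \<le> 6 * enn2real (\<nu> X)"
    using short_chain[OF assms] by metis
  \<comment> \<open>The minimum only matters for \<open>t > 1\<close>, where the value has to stay in \<open>X\<close>.\<close>
  define i where "i t = min n (nat \<lfloor>real n * t\<rfloor>)" for t :: real
  show ?thesis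
  proof (intro exI[of _ "\<lambda>t. z (i t)"] conjI allI ballI)
    show "z (i t) \<in> X" for t
      by (intro z(3)) (simp add: i_def)
    show "z (i 0) = x" "z (i 1) = y"
      using z by (simp_all add: i_def)
    fix s t :: real assume st: "s \<in> {0..1}" "t \<in> {0..1}"
    have it: "real (i t) = of_int \<lfloor>real n * t\<rfloor>" if "t \<in> {0..1}" for t
    proof -
      have "0 \<le> real n * t" "real n * t \<le> real n"
        using that by (auto intro: mult_left_le)
      then have "0 \<le> \<lfloor>real n * t\<rfloor>" "\<lfloor>real n * t\<rfloor> \<le> int n"
        by linarith+
      then show ?thesis by (simp add: i_def)
    qed
    have "dist (z (i s)) (z (i t)) \<le> \<bar>real (i s) - real (i t)\<bar> * \<delta>"
      using z(4) by (intro chain_dist[of n]) (auto simp: i_def less_imp_le)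
    also have "\<dots> \<le> (\<bar>real n * s - real n * t\<bar> + 1) * \<delta>"
      unfolding it[OF st(1)] it[OF st(2)] using \<delta>(1) by (intro mult_right_mono) linarith+
    also have "\<bar>real n * s - real n * t\<bar> = real n * \<bar>s - t\<bar>"
      by (simp add: abs_mult flip: right_diff_distrib)
    also have "(real n * \<bar>s - t\<bar> + 1) * \<delta> = (real n * \<delta>) * \<bar>s - t\<bar> + \<delta>"
      by (simp add: algebra_simps)
    also have "\<dots> \<le> 6 * enn2real (\<nu> X) * \<bar>s - t\<bar> + \<delta>"
      by (intro add_right_mono mult_right_mono n) auto
    finally show "dist (z (i s)) (z (i t)) \<le> 6 * enn2real (\<nu> X) * \<bar>s - t\<bar> + \<delta>" .
  qed
qed

text \<open>
The approximate paths for smaller and smaller \<open>\<delta>\<close> form a decreasing sequence of nonempty closed subsets of a product of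
copies of \<open>X\<close>.  A common element exists by Tychonoff's theorem, and it is a Lipschitz path.
\<close>

lemma finite_length_path_connected:
  fixes X :: "'a::euclidean_space set"
  assumes \<nu>: "length_content \<nu>" and X: "compact X" "connected X" and fin: "\<nu> X < top"
  shows "path_connected X"
  unfolding path_connected_def
proof (intro ballI)
  fix x y assume xy: "x \<in> X" "y \<in> X"
  show "\<exists>g. path g \<and> path_image g \<subseteq> X \<and> pathstart g = x \<and> pathfinish g = y"
  proof (cases "x = y")
    case True
    then show ?thesis
      using xy by (intro exI[of _ "linepath x x"]) auto
  next
    case False
    define L where "L = 6 * enn2real (\<nu> X)"
    \<comment> \<open>The summand \<open>2\<close> keeps every \<open>d k\<close> below \<open>dist x y\<close>.\<close>
    define d where "d k = dist x y / (real k + 2)" for k :: nat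
    have d: "0 < d k" "d k < dist x y" for k
    proof -
      have "dist x y * 1 < dist x y * (real k + 2)"
        using False by (intro mult_strict_left_mono) auto
      then show "0 < d k" "d k < dist x y"
        using False by (auto simp: d_def divide_less_eq)
    qed
    define E where "E k = {f :: real \<Rightarrow> 'a. f 0 = x \<and> f 1 = y \<and>
        (\<forall>s\<in>{0..1}. \<forall>t\<in>{0..1}. dist (f s) (f t) \<le> L * \<bar>s - t\<bar> + d k)}" for k
    have E_anti: "E l \<subseteq> E k" if "k \<le> l" for k l
    proof -
      have "d l \<le> d k"
        using that by (auto simp: d_def intro!: divide_left_mono)
      then show ?thesis
        by (fastforce simp: E_def)
    qed
    have "compact (PiE UNIV (\<lambda>_. X) :: (real \<Rightarrow> 'a) set)"
      using X(1) compactin_PiE[of "\<lambda>_. euclidean" UNIV "\<lambda>_::real. X"]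
      by (simp add: euclidean_product_topology)
    then have "PiE UNIV (\<lambda>_. X) \<inter> (\<Inter>k\<in>UNIV. E k) \<noteq> {}"
    proof (rule compact_imp_fip_image)
      fix k
      have E_eq: "E k = {f. f 0 = x} \<inter> {f. f 1 = y} \<inter>
        (\<Inter>s\<in>{0..1}. \<Inter>t\<in>{0..1}. {f. dist (f s) (f t) \<le> L * \<bar>s - t\<bar> + d k})"
        by (auto simp: E_def)
      show "closed (E k)"
        unfolding E_eq
        by (intro closed_Int closed_INT ballI closed_Collect_eq closed_Collect_le continuous_intros
            continuous_on_product_coordinates)
    next
      fix I :: "nat set" assume "finite I"
      then obtain m where m: "\<And>k. k \<in> I \<Longrightarrow> k \<le> m"
        using finite_nat_set_iff_bounded_le by metis
      obtain f :: "real \<Rightarrow> 'a" where "\<forall>t. f t \<in> X" "f \<in> E m"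
        using approximate_path[OF \<nu> X fin xy d[of m]] unfolding E_def L_def by auto
      moreover have "f \<in> E k" if "k \<in> I" for k
        using E_anti[OF m[OF that]] \<open>f \<in> E m\<close> by blast
      ultimately have "f \<in> PiE UNIV (\<lambda>_. X) \<inter> (\<Inter>k\<in>I. E k)"
        by auto
      then show "PiE UNIV (\<lambda>_. X) \<inter> (\<Inter>k\<in>I. E k) \<noteq> {}"
        by blast
    qed
    then obtain f :: "real \<Rightarrow> 'a" where f: "\<And>t. f t \<in> X" "\<And>k. f \<in> E k"
      by auto
    have lip: "dist (f s) (f t) \<le> L * \<bar>s - t\<bar>" if "s \<in> {0..1}" "t \<in> {0..1}" for s t
    proof (rule LIMSEQ_le_const)
      have "(\<lambda>k. d k) \<longlonglongrightarrow> 0"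
        unfolding d_def by real_asymp
      then show "(\<lambda>k. L * \<bar>s - t\<bar> + d k) \<longlonglongrightarrow> L * \<bar>s - t\<bar>"
        using tendsto_add[of "\<lambda>_. L * \<bar>s - t\<bar>"] by fastforce
      show "\<exists>N. \<forall>k\<ge>N. dist (f s) (f t) \<le> L * \<bar>s - t\<bar> + d k"
        using f(2) that unfolding E_def by blast
    qed
    have "L-lipschitz_on {0..1} f"
      using lip by (intro lipschitz_onI) (auto simp: dist_real_def L_def)
    then have "path f"
      unfolding path_def by (rule lipschitz_on_continuous_on)
    then show ?thesis
      using f(1) f(2)[of 0] by (intro exI[of _ f]) (auto simp: path_image_def pathstart_def pathfinish_def E_def)
  qed
qed

lemma short_continuum_translates_into_interior:
  fixes K :: "'a::euclidean_space set"
  assumes K: "convex_body K" and \<nu>: "length_content \<nu>"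
    and X: "compact X" "connected X" and short: "\<nu> X < ennreal (min_width K)"
  obtains v where "\<And>x. x \<in> X \<Longrightarrow> x + v \<in> interior K"
proof -
  note w = min_width_pos[OF K]
  have K': "compact K" "convex K" "K \<noteq> {}"
    using K interior_subset by (auto simp: convex_body_def)
  have fin: "\<nu> X < top"
    using short by (rule less_trans) simp
  define r where "r = enn2real (\<nu> X) / min_width K"
  have r: "0 \<le> r" "r < 1"
    using w short fin by (auto simp: r_def enn2real_less_iff)
  note pc = finite_length_path_connected[OF \<nu> X fin]
  have "fits K X r"
  proof (rule fits_of_finite_subsets[OF K'(1)])
    fix F assume F: "finite F" "F \<subseteq> X"
    show "fits K F r"
    proof (cases "F = {}")
      case True
      then show ?thesis by (simp add: fits_def)
    next
      case False
      obtain T where T: "F \<subseteq> T" "T \<subseteq> X"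
        "\<And>G. finite G \<Longrightarrow> G \<subseteq> T \<Longrightarrow> fits K G (enn2real (inner_content \<nu> T) / min_width K)"
        using tree_fits[OF K \<nu> pc fin F(1) False F(2)] by blast
      have a: "fits K F (enn2real (inner_content \<nu> T) / min_width K)"
        using T(3) F(1) T(1) .
      have b: "enn2real (inner_content \<nu> T) / min_width K \<le> r"
        unfolding r_def using w by (intro divide_right_mono enn2real_mono inner_content_le \<nu> T(2) fin) auto
      show ?thesis
        by (rule fits_mono[OF K'(2,3) _ b a]) (use w in simp)
    qed
  qed
  then show thesis
    using fits_into_interior[OF K r] that by blast
qed

section \<open>Locally constant translations of fibres\<close>

text \<open>
Points near \<open>F\<close> are moved into \<open>W\<close> by a translation vector that depends on the point.  A continuous function with
finitely many values is locally constant; the finiteness of the values is what later bounds the dimension.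
\<close>

definition piecewise_shiftable :: "'a::euclidean_space set \<Rightarrow> 'a set \<Rightarrow> bool" where
  "piecewise_shiftable W F \<longleftrightarrow>
     (\<exists>U v. open U \<and> F \<subseteq> U \<and> finite (v ` U) \<and> continuous_on U v \<and> (\<forall>x\<in>U. x + v x \<in> W))"

lemma piecewise_shiftable_subset:
  "piecewise_shiftable W G \<Longrightarrow> F \<subseteq> G \<Longrightarrow> piecewise_shiftable W F"
  unfolding piecewise_shiftable_def by (meson subset_trans)

lemma piecewise_shiftable_translation:
  assumes "open W" "\<And>x. x \<in> F \<Longrightarrow> x + v \<in> W"
  shows "piecewise_shiftable W F"
  unfolding piecewise_shiftable_def
proof (intro exI[of _ "(\<lambda>x. x + v) -` W"] exI[of _ "\<lambda>_. v"] conjI)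
  show "open ((\<lambda>x. x + v) -` W)"
    by (intro continuous_open_vimage assms continuous_intros)
  show "finite ((\<lambda>_. v) ` (\<lambda>x. x + v) -` W)"
    by (rule finite_subset[of _ "{v}"]) auto
qed (use assms in auto)

lemma piecewise_shiftable_Un:
  assumes A: "compact A" "piecewise_shiftable W A" and B: "compact B" "piecewise_shiftable W B"
    and disj: "A \<inter> B = {}"
  shows "piecewise_shiftable W (A \<union> B)"
proof -
  obtain U v where U: "open U" "A \<subseteq> U" "finite (v ` U)" "continuous_on U v" "\<forall>x\<in>U. x + v x \<in> W"
    using A unfolding piecewise_shiftable_def by blast
  obtain U' v' where U': "open U'" "B \<subseteq> U'" "finite (v' ` U')" "continuous_on U' v'" "\<forall>x\<in>U'. x + v' x \<in> W"
    using B unfolding piecewise_shiftable_def by blast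
  obtain O1 O2 where O: "open O1" "open O2" "A \<subseteq> O1" "B \<subseteq> O2" "O1 \<inter> O2 = {}"
    using separation_normal[OF compact_imp_closed[OF A(1)] compact_imp_closed[OF B(1)] disj] by metis
  define u where "u x = (if x \<in> U \<inter> O1 then v x else v' x)" for x
  have u1: "u x = v x" if "x \<in> U \<inter> O1" for x
    using that by (simp add: u_def)
  have u2: "u x = v' x" if "x \<in> U' \<inter> O2" for x
    using that O(5) by (auto simp: u_def)
  show ?thesis
    unfolding piecewise_shiftable_def
  proof (intro exI[of _ "U \<inter> O1 \<union> U' \<inter> O2"] exI[of _ u] conjI ballI)
    show "open (U \<inter> O1 \<union> U' \<inter> O2)"
      by (intro open_Un open_Int U(1) U'(1) O)
    show "A \<union> B \<subseteq> U \<inter> O1 \<union> U' \<inter> O2"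
      using U(2) U'(2) O by blast
    have "u ` (U \<inter> O1 \<union> U' \<inter> O2) \<subseteq> v ` U \<union> v' ` U'"
      using u1 u2 by auto
    then show "finite (u ` (U \<inter> O1 \<union> U' \<inter> O2))"
      using U(3) U'(3) by (meson finite_UnI finite_subset)
    show "continuous_on (U \<inter> O1 \<union> U' \<inter> O2) u"
    proof (rule continuous_on_open_Un)
      have "continuous_on (U \<inter> O1) v"
        using U(4) by (rule continuous_on_subset) auto
      then show "continuous_on (U \<inter> O1) u"
        by (rule continuous_on_eq) (simp add: u1)
      have "continuous_on (U' \<inter> O2) v'"
        using U'(4) by (rule continuous_on_subset) auto
      then show "continuous_on (U' \<inter> O2) u"
        by (rule continuous_on_eq) (simp add: u2)
    qed (intro open_Int U(1) U'(1) O)+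
    fix x assume "x \<in> U \<inter> O1 \<union> U' \<inter> O2"
    then show "x + u x \<in> W"
      using u1[of x] u2[of x] U(5) U'(5) by auto
  qed
qed

text \<open>
By the Sura-Bura theorem every component of the compact set \<open>F\<close> has a clopen neighbourhood in \<open>F\<close> that is moved into \<open>W\<close> by
the vector of the component.  Finitely many of these cover \<open>F\<close>, and they are made disjoint one after the other.
\<close>

lemma piecewise_shiftable_of_components:
  fixes F W :: "'a::euclidean_space set"
  assumes F: "compact F" and W: "open W"
    and comp: "\<And>C. C \<in> components F \<Longrightarrow> \<exists>v. \<forall>x\<in>C. x + v \<in> W"
  shows "piecewise_shiftable W F"
proof -
  define \<D> where "\<D> = {D. openin (top_of_set F) D \<and> compact D \<and> piecewise_shiftable W D}"
  have "F \<subseteq> \<Union>\<D>"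
  proof
    fix x assume x: "x \<in> F"
    define C where "C = connected_component_set F x"
    have C: "C \<in> components F" "x \<in> C"
      using x by (auto simp: C_def components_def)
    obtain v where v: "\<forall>y\<in>C. y + v \<in> W"
      using comp[OF C(1)] by blast
    let ?U = "(\<lambda>y. y + v) -` W"
    have "open ?U"
      by (intro continuous_open_vimage W continuous_intros)
    moreover have "C \<subseteq> ?U"
      using v by auto
    ultimately obtain D where D: "openin (top_of_set F) D" "compact D" "C \<subseteq> D" "D \<subseteq> ?U"
      using Sura_Bura_clopen_subset[OF closed_imp_locally_compact[OF compact_imp_closed[OF F]] C(1)
          compact_components[OF F C(1)]] by metis
    then have "piecewise_shiftable W D"
      by (intro piecewise_shiftable_translation[OF W, of _ v]) auto
    with D C(2) show "x \<in> \<Union>\<D>"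
      unfolding \<D>_def by blast
  qed
  moreover have "\<forall>D\<in>\<D>. openin (top_of_set F) D"
    by (simp add: \<D>_def)
  ultimately obtain \<E> where \<E>: "\<E> \<subseteq> \<D>" "finite \<E>" "F \<subseteq> \<Union>\<E>"
    using F unfolding compact_eq_openin_cover by meson
  have "piecewise_shiftable W (\<Union>\<E>) \<and> compact (\<Union>\<E>)"
    using \<E>(2,1)
  proof (induction \<E> rule: finite_induct)
    case empty
    show ?case
      using piecewise_shiftable_translation[OF W, of "{}"] by simp
  next
    case (insert D \<E>)
    have D: "openin (top_of_set F) D" "compact D" "piecewise_shiftable W D"
      using insert.prems by (auto simp: \<D>_def)
    obtain U where U: "open U" "D = F \<inter> U"
      using D(1) unfolding openin_open by blast
    have "\<Union>\<E> \<subseteq> F"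
      using insert.prems openin_imp_subset by (fastforce simp: \<D>_def)
    then have eq: "\<Union>\<E> - D = \<Union>\<E> - U"
      using U(2) by blast
    have cE: "compact (\<Union>\<E> - D)"
      unfolding eq using insert U(1) by (intro compact_diff) auto
    have "piecewise_shiftable W (D \<union> (\<Union>\<E> - D))"
      using insert cE D by (intro piecewise_shiftable_Un) (auto intro: piecewise_shiftable_subset)
    moreover have "D \<union> (\<Union>\<E> - D) = \<Union>(insert D \<E>)"
      by blast
    ultimately show ?case
      using insert D(2) by (auto intro: compact_Un)
  qed
  then show ?thesis
    using \<E>(3) piecewise_shiftable_subset by blast
qed

lemma negligible_convex_hull_few_points:
  fixes S :: "'a::euclidean_space set"
  assumes "finite S" "card S \<le> DIM('a)"
  shows "negligible (convex hull S)"
proof -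
  have "aff_dim (convex hull S) < int DIM('a)"
    using aff_dim_le_card[OF assms(1)] assms(2) by (simp add: aff_dim_convex_hull)
  then have "interior (convex hull S) = {}"
    using aff_dim_nonempty_interior by force
  then show ?thesis
    by (simp add: negligible_convex_interior)
qed

text \<open>
The compact set of all \<open>x + q x\<close> has positive distance from the boundary of \<open>K\<close>.  Hence \<open>x + q x - z\<close> stays in \<open>K\<close> for
all small \<open>z\<close>, and a Brouwer fixed point of this map satisfies \<open>q x = z\<close>.
\<close>

lemma displacement_covers_ball:
  fixes K :: "'a::euclidean_space set"
  assumes K: "convex_body K" and q: "continuous_on K q" and int: "\<And>x. x \<in> K \<Longrightarrow> x + q x \<in> interior K"
  shows "\<not> negligible (q ` K)"
proof -
  have K': "compact K" "convex K" "K \<noteq> {}"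
    using K interior_subset by (auto simp: convex_body_def)
  have "compact ((\<lambda>x. x + q x) ` K)"
    by (intro compact_continuous_image K' continuous_intros q)
  moreover have "(\<lambda>x. x + q x) ` K \<subseteq> interior K"
    using int by auto
  ultimately obtain e where e: "e > 0" "(\<Union>y\<in>(\<lambda>x. x + q x) ` K. ball y e) \<subseteq> interior K"
    using compact_subset_open_imp_ball_epsilon_subset by (metis open_interior)
  have "ball 0 e \<subseteq> q ` K"
  proof
    fix z :: 'a assume z: "z \<in> ball 0 e"
    have "(\<lambda>x. x + q x - z) \<in> K \<rightarrow> K"
    proof
      fix x assume "x \<in> K"
      then have "x + q x - z \<in> (\<Union>y\<in>(\<lambda>x. x + q x) ` K. ball y e)"
        using z by (auto intro!: bexI[of _ x] simp: dist_norm)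
      then show "x + q x - z \<in> K"
        using e(2) interior_subset by blast
    qed
    moreover have "continuous_on K (\<lambda>x. x + q x - z)"
      by (intro continuous_intros q)
    ultimately obtain x where "x \<in> K" "x + q x - z = x"
      using brouwer[OF K', of "\<lambda>x. x + q x - z"] by blast
    then have "z = q x"
      by (simp add: algebra_simps)
    with \<open>x \<in> K\<close> show "z \<in> q ` K"
      by blast
  qed
  then show ?thesis
    using open_not_negligible[of "ball 0 e"] e(1) negligible_subset by auto
qed

text \<open>
The weighted mean \<open>q\<close> of the translation vectors moves \<open>K\<close> into its interior by convexity, so that its values
are not negligible.  Since at most \<open>DIM('a)\<close> weights are positive at a time, each value lies in one
of finitely many simplices of lower dimension.
\<close>

lemma weighted_translations_small_multiplicity:
  fixes K :: "'a::euclidean_space set" and \<psi> :: "'i \<Rightarrow> 'a \<Rightarrow> real" and v :: "'i \<Rightarrow> 'a \<Rightarrow> 'a"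
  assumes K: "convex_body K" and I: "finite I"
    and nonneg: "\<And>i x. i \<in> I \<Longrightarrow> x \<in> K \<Longrightarrow> 0 \<le> \<psi> i x"
    and cont: "\<And>i. i \<in> I \<Longrightarrow> continuous_on K (\<psi> i)" "\<And>i. i \<in> I \<Longrightarrow> continuous_on K (\<lambda>x. \<psi> i x *\<^sub>R v i x)"
    and shift: "\<And>i x. i \<in> I \<Longrightarrow> x \<in> K \<Longrightarrow> 0 < \<psi> i x \<Longrightarrow> x + v i x \<in> interior K"
    and fin: "\<And>i. i \<in> I \<Longrightarrow> finite (v i ` {x\<in>K. 0 < \<psi> i x})"
    and covered: "\<And>x. x \<in> K \<Longrightarrow> \<exists>i\<in>I. 0 < \<psi> i x"
    and mult: "\<And>x. x \<in> K \<Longrightarrow> card {i\<in>I. 0 < \<psi> i x} \<le> DIM('a)"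
  shows False
proof -
  define A where "A x = {i\<in>I. 0 < \<psi> i x}" for x
  define s where "s x = (\<Sum>i\<in>I. \<psi> i x)" for x
  define q where "q x = (\<Sum>i\<in>I. (1 / s x) *\<^sub>R \<psi> i x *\<^sub>R v i x)" for x
  have s: "0 < s x" if x: "x \<in> K" for x
  proof -
    obtain i where "i \<in> I" "0 < \<psi> i x"
      using covered[OF x] by blast
    then show ?thesis
      unfolding s_def using I nonneg x by (intro sum_pos2) auto
  qed
  have qA: "q x = (\<Sum>i\<in>A x. (\<psi> i x / s x) *\<^sub>R v i x)" "(\<Sum>i\<in>A x. \<psi> i x / s x) = 1" if x: "x \<in> K" for x
  proof -
    have z: "\<psi> i x = 0" if "i \<in> I - A x" for i
      using nonneg[of i x] x that by (auto simp: A_def)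
    show "q x = (\<Sum>i\<in>A x. (\<psi> i x / s x) *\<^sub>R v i x)"
    proof -
      have "q x = (\<Sum>i\<in>I. (\<psi> i x / s x) *\<^sub>R v i x)"
        by (simp add: q_def)
      also have "\<dots> = (\<Sum>i\<in>A x. (\<psi> i x / s x) *\<^sub>R v i x)"
        by (rule sum.mono_neutral_right) (use I z in \<open>auto simp: A_def\<close>)
      finally show ?thesis .
    qed
    have "s x = (\<Sum>i\<in>A x. \<psi> i x)"
      unfolding s_def by (rule sum.mono_neutral_right) (use I z in \<open>auto simp: A_def\<close>)
    then show "(\<Sum>i\<in>A x. \<psi> i x / s x) = 1"
      using s[OF x] by (simp flip: sum_divide_distrib)
  qed
  have finA: "finite (A x)" for x
    using I by (simp add: A_def)
  have "\<not> negligible (q ` K)"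
  proof (rule displacement_covers_ball[OF K])
    have "continuous_on K s"
      unfolding s_def by (intro continuous_intros cont)
    then show "continuous_on K q"
      unfolding q_def using s by (intro continuous_intros cont) force+
    fix x assume x: "x \<in> K"
    have "x + q x = (\<Sum>i\<in>A x. (\<psi> i x / s x) *\<^sub>R (x + v i x))"
      unfolding scaleR_add_right sum.distrib qA(1)[OF x] scaleR_left.sum[symmetric] qA(2)[OF x] by simp
    also have "\<dots> \<in> interior K"
      using K s[OF x] by (intro convex_sum finA qA x convex_interior)
        (auto simp: convex_body_def A_def intro: shift x)
    finally show "x + q x \<in> interior K" .
  qed
  moreover have "negligible (q ` K)"
  proof -
    define R where "R = (\<Union>i\<in>I. v i ` {x\<in>K. 0 < \<psi> i x})"
    have R: "finite R"
      unfolding R_def using I fin by blast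
    have "q ` K \<subseteq> (\<Union>S\<in>{S. S \<subseteq> R \<and> card S \<le> DIM('a)}. convex hull S)"
    proof
      fix z assume "z \<in> q ` K"
      then obtain x where x: "x \<in> K" "z = q x" by blast
      let ?S = "(\<lambda>i. v i x) ` A x"
      have "q x \<in> convex hull ?S"
        unfolding qA(1)[OF x(1)] using s[OF x(1)]
        by (intro convex_sum finA qA x convex_convex_hull) (auto simp: A_def intro: hull_inc)
      moreover have "?S \<subseteq> R"
        using x by (auto simp: A_def R_def)
      moreover have "card ?S \<le> DIM('a)"
        using card_image_le[OF finA, of "\<lambda>i. v i x" x] mult[OF x(1)] by (simp add: A_def)
      ultimately show "z \<in> (\<Union>S\<in>{S. S \<subseteq> R \<and> card S \<le> DIM('a)}. convex hull S)"
        using x(2) by blast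
    qed
    moreover have "negligible (\<Union>S\<in>{S. S \<subseteq> R \<and> card S \<le> DIM('a)}. convex hull S)"
      using R by (intro negligible_Union) (auto intro: negligible_convex_hull_few_points finite_subset)
    ultimately show ?thesis
      by (rule negligible_subset[rotated])
  qed
  ultimately show False by blast
qed

section \<open>Cubes of small multiplicity\<close>

text \<open>
An index \<open>(j, c)\<close> consists of a colour \<open>j < n\<close> and an integer vector \<open>c\<close>.  The cubes of colour \<open>j\<close> form the
grid of mesh \<open>1 / N\<close> shifted by \<open>j / (n N)\<close> in every direction, and the cell \<open>(j, c)\<close> is the
open cube on which all cell coordinates lie between \<open>0\<close> and \<open>1\<close>.
\<close>

definition cell_coordinate :: "nat \<Rightarrow> real \<Rightarrow> nat \<times> ('a::euclidean_space \<Rightarrow> int) \<Rightarrow> 'a \<Rightarrow> 'a \<Rightarrow> real" where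
  "cell_coordinate n N i z b = N * (z \<bullet> b) - real (fst i) / real n - of_int (snd i b)"

text \<open>
A continuous function that is positive exactly on the open cell.
\<close>

definition cell_bump :: "'a set \<Rightarrow> nat \<Rightarrow> real \<Rightarrow> nat \<times> ('a::euclidean_space \<Rightarrow> int) \<Rightarrow> 'a \<Rightarrow> real" where
  "cell_bump B n N i z = (\<Prod>b\<in>B. max 0 (cell_coordinate n N i z b * (1 - cell_coordinate n N i z b)))"

lemma cell_bump_nonneg: "0 \<le> cell_bump B n N i z"
  unfolding cell_bump_def by (intro prod_nonneg) auto

lemma cell_bump_pos_iff:
  assumes "finite B"
  shows "0 < cell_bump B n N i z \<longleftrightarrow>
    (\<forall>b\<in>B. 0 < cell_coordinate n N i z b \<and> cell_coordinate n N i z b < 1)"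
proof -
  have *: "0 < max 0 (t * (1 - t)) \<longleftrightarrow> 0 < t \<and> t < 1" for t :: real
    by (auto simp: max_def zero_less_mult_iff)
  have "0 < cell_bump B n N i z \<longleftrightarrow>
      (\<forall>b\<in>B. 0 < max 0 (cell_coordinate n N i z b * (1 - cell_coordinate n N i z b)))"
  proof
    assume "0 < cell_bump B n N i z"
    then have "max 0 (cell_coordinate n N i z b * (1 - cell_coordinate n N i z b)) \<noteq> 0" if "b \<in> B" for b
      using that assms unfolding cell_bump_def by (metis less_irrefl prod_zero)
    then show "\<forall>b\<in>B. 0 < max 0 (cell_coordinate n N i z b * (1 - cell_coordinate n N i z b))"
      by (metis less_le max.cobounded1)
  next
    assume "\<forall>b\<in>B. 0 < max 0 (cell_coordinate n N i z b * (1 - cell_coordinate n N i z b))"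
    then show "0 < cell_bump B n N i z"
      unfolding cell_bump_def by (intro prod_pos) blast
  qed
  then show ?thesis
    unfolding * .
qed

lemma floor_unique_in_unit:
  fixes r :: real
  assumes "0 < r - of_int c" "r - of_int c < 1"
  shows "c = \<lfloor>r\<rfloor>"
  using assms by linarith

text \<open>
A point lies in no open cube of colour \<open>j\<close> only if one of its coordinates is on a wall of the grid of that colour.
The walls of different colours are disjoint for each coordinate direction, so fewer than \<open>n\<close> coordinates cannot
exclude all \<open>n\<close> colours.
\<close>

lemma cell_exists:
  fixes B :: "'a::euclidean_space set"
  assumes B: "finite B" "card B < n" and M: "\<And>b. b \<in> B \<Longrightarrow> \<bar>N * (z \<bullet> b)\<bar> \<le> real_of_int M"
  shows "\<exists>i\<in>{..<n} \<times> (B \<rightarrow>\<^sub>E {-M-2..M+2}). 0 < cell_bump B n N i z"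
proof -
  have n: "0 < n" using B by simp
  \<comment> \<open>The colours that coordinate \<open>b\<close> excludes: two of them would differ by an integer multiple of \<open>n\<close>.\<close>
  define bad where "bad b = {j\<in>{..<n}. N * (z \<bullet> b) - real j / real n \<in> \<int>}" for b
  have card_bad: "card (bad b) \<le> 1" for b
  proof -
    have "j = k" if jk: "j \<in> bad b" "k \<in> bad b" for j k
    proof -
      have "N * (z \<bullet> b) - real j / real n \<in> \<int>" "N * (z \<bullet> b) - real k / real n \<in> \<int>"
        using jk by (auto simp: bad_def)
      then have "(N * (z \<bullet> b) - real j / real n) - (N * (z \<bullet> b) - real k / real n) \<in> \<int>"
        by (rule Ints_diff)
      then have "(real k - real j) / real n \<in> \<int>"
        by (simp add: diff_divide_distrib)
      then obtain m where m: "(real k - real j) / real n = of_int m"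
        by (auto elim: Ints_cases)
      have "\<bar>real k - real j\<bar> < real n"
        using jk by (auto simp: bad_def)
      then have "\<bar>(real k - real j) / real n\<bar> < 1"
        using n by simp
      then have "m = 0"
        unfolding m by linarith
      with m n show "j = k" by simp
    qed
    then show ?thesis
      by (metis card_eq_0_iff card_le_Suc0_iff_eq One_nat_def le0)
  qed
  have "card (\<Union>b\<in>B. bad b) \<le> (\<Sum>b\<in>B. card (bad b))"
    by (rule card_UN_le[OF B(1)])
  also have "\<dots> \<le> (\<Sum>b\<in>B. 1)"
    by (intro sum_mono card_bad)
  also have "\<dots> < card {..<n}"
    using B by simp
  finally have "\<not> {..<n} \<subseteq> (\<Union>b\<in>B. bad b)"
    using card_mono[of "\<Union>b\<in>B. bad b" "{..<n}"] B(1) by (fastforce simp: bad_def)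
  then obtain j where j: "j < n" "\<And>b. b \<in> B \<Longrightarrow> N * (z \<bullet> b) - real j / real n \<notin> \<int>"
    by (auto simp: bad_def)
  define c where "c = (\<lambda>b\<in>B. \<lfloor>N * (z \<bullet> b) - real j / real n\<rfloor>)"
  have "0 < cell_bump B n N (j, c) z"
    unfolding cell_bump_pos_iff[OF B(1)]
  proof
    fix b assume b: "b \<in> B"
    let ?r = "N * (z \<bullet> b) - real j / real n"
    define m where "m = \<lfloor>?r\<rfloor>"
    have "?r \<noteq> of_int m"
      using j(2)[OF b] by (metis Ints_of_int)
    then have "0 < ?r - of_int m" "?r - of_int m < 1"
      unfolding m_def by linarith+
    moreover have "cell_coordinate n N (j, c) z b = ?r - of_int m"
      using b by (simp add: cell_coordinate_def c_def m_def)
    ultimately show "0 < cell_coordinate n N (j, c) z b \<and> cell_coordinate n N (j, c) z b < 1"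
      by simp
  qed
  moreover have "c \<in> B \<rightarrow>\<^sub>E {-M-2..M+2}"
  proof
    fix b assume b: "b \<in> B"
    have "0 \<le> real j / real n" "real j / real n < 1"
      using j(1) by auto
    moreover have "N * (z \<bullet> b) \<le> of_int M" "- of_int M \<le> N * (z \<bullet> b)"
      using M[OF b] by linarith+
    ultimately have "- M - 2 \<le> \<lfloor>N * (z \<bullet> b) - real j / real n\<rfloor>"
        "\<lfloor>N * (z \<bullet> b) - real j / real n\<rfloor> \<le> M + 2"
      by linarith+
    then show "c b \<in> {-M-2..M+2}"
      using b by (simp add: c_def)
  qed (simp add: c_def)
  ultimately show ?thesis
    using j(1) by blast
qed

text \<open>
Open cubes of the same colour are disjoint.
\<close>

lemma cell_multiplicity:
  fixes B :: "'a::euclidean_space set"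
  assumes B: "finite B"
  shows "card {i \<in> {..<n} \<times> (B \<rightarrow>\<^sub>E C). 0 < cell_bump B n N i z} \<le> n"
proof -
  let ?A = "{i \<in> {..<n} \<times> (B \<rightarrow>\<^sub>E C). 0 < cell_bump B n N i z}"
  have "inj_on fst ?A"
  proof (rule inj_onI)
    fix i k assume i: "i \<in> ?A" and k: "k \<in> ?A" and eq: "fst i = fst k"
    have "snd i = snd k"
    proof (rule extensionalityI[of _ B])
      show "snd i \<in> extensional B" "snd k \<in> extensional B"
        using i k by (auto simp: PiE_def)
      fix b assume "b \<in> B"
      then have "snd i b = \<lfloor>N * (z \<bullet> b) - real (fst i) / real n\<rfloor>" "snd k b = \<lfloor>N * (z \<bullet> b) - real (fst k) / real n\<rfloor>"
        using i k by (auto simp: cell_bump_pos_iff[OF B] cell_coordinate_def intro!: floor_unique_in_unit)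
      then show "snd i b = snd k b"
        using eq by simp
    qed
    with eq show "i = k"
      by (simp add: prod_eq_iff)
  qed
  then have "card ?A \<le> card {..<n}"
    by (rule card_inj_on_le) auto
  then show ?thesis by simp
qed

text \<open>
The condition \<open>g x \<bullet> e = 0\<close> expresses a map into \<open>(n-1)\<close>-space.  If all cubes are smaller than a Lebesgue number of the
covering of \<open>g ` K\<close> by sets over which a locally constant translation is available, each cube inherits
such a translation, and the bump functions serve as weights.
\<close>

lemma fibers_not_all_piecewise_shiftable:
  fixes K :: "'a::euclidean_space set" and g :: "'a \<Rightarrow> 'a"
  assumes K: "convex_body K" and g: "continuous_on K g"
    and e: "e \<in> Basis" "\<And>x. x \<in> K \<Longrightarrow> g x \<bullet> e = 0"
    and shift: "\<And>y. piecewise_shiftable (interior K) (K \<inter> g -` {y})"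
  shows False
proof -
  have K': "compact K" "convex K" "K \<noteq> {}"
    using K interior_subset by (auto simp: convex_body_def)
  define n where "n = DIM('a)"
  have n: "0 < n" by (simp add: n_def)
  define B where "B = Basis - {e}"
  have B: "finite B" "card B < n" "B \<subseteq> Basis"
    using e(1) n by (auto simp: B_def n_def)
  have "\<forall>y. \<exists>U v. open U \<and> K \<inter> g -` {y} \<subseteq> U \<and> finite (v ` U) \<and> continuous_on U v \<and>
      (\<forall>x\<in>U. x + v x \<in> interior K)"
    using shift unfolding piecewise_shiftable_def by blast
  from choice[OF this] obtain U where "\<forall>y. \<exists>v. open (U y) \<and> K \<inter> g -` {y} \<subseteq> U y \<and>
      finite (v ` U y) \<and> continuous_on (U y) v \<and> (\<forall>x\<in>U y. x + v x \<in> interior K)" ..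
  from choice[OF this] obtain v where "\<forall>y. open (U y) \<and> K \<inter> g -` {y} \<subseteq> U y \<and>
      finite (v y ` U y) \<and> continuous_on (U y) (v y) \<and> (\<forall>x\<in>U y. x + v y x \<in> interior K)" ..
  then have U: "\<And>y. open (U y)" "\<And>y. K \<inter> g -` {y} \<subseteq> U y" "\<And>y. finite (v y ` U y)"
      "\<And>y. continuous_on (U y) (v y)" "\<And>x y. x \<in> U y \<Longrightarrow> x + v y x \<in> interior K"
    by simp_all
  \<comment> \<open>The points over which the translations chosen for the fibre of \<open>y\<close> are defined.\<close>
  define V where "V y = - g ` (K - U y)" for y
  have gK: "compact (g ` K)"
    by (intro compact_continuous_image g K')
  have cover: "g ` K \<subseteq> \<Union>(range V)"
  proof
    fix z assume "z \<in> g ` K"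
    have "z \<notin> g ` (K - U z)"
      using U(2)[of z] by blast
    then show "z \<in> \<Union>(range V)"
      unfolding V_def by blast
  qed
  have "open (V y)" for y
    unfolding V_def
    by (intro open_Compl compact_imp_closed compact_continuous_image continuous_on_subset[OF g]
        compact_diff K' U(1)) auto
  then have opn: "\<And>G. G \<in> range V \<Longrightarrow> open G"
    by auto
  obtain \<delta> where \<delta>: "0 < \<delta>" "\<And>z. z \<in> g ` K \<Longrightarrow> \<exists>G\<in>range V. ball z \<delta> \<subseteq> G"
    using Heine_Borel_lemma[OF gK cover opn] by metis
  \<comment> \<open>Two points of a closed cell differ by at most \<open>1 / N\<close> in each coordinate, hence by less than \<open>\<delta>\<close>.\<close>
  define N where "N = real n / \<delta> + 1"
  have N: "0 < N" "real n / N < \<delta>"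
    using \<delta>(1) n by (auto simp: N_def field_simps add_pos_pos)
  obtain D where D: "\<And>x. x \<in> K \<Longrightarrow> norm (g x) \<le> D"
    using compact_imp_bounded[OF gK] by (auto simp: bounded_iff)
  define M where "M = \<lceil>N * D\<rceil>"
  define I where "I = {..<n} \<times> (B \<rightarrow>\<^sub>E {-M-2..M+2})"
  define \<psi> where "\<psi> i x = cell_bump B n N i (g x)" for i x
  define Q where "Q i = {x\<in>K. \<forall>b\<in>B. cell_coordinate n N i (g x) b \<in> {0..1}}" for i
  have QU: "\<exists>y. Q i \<subseteq> U y" for i
  proof (cases "Q i = {}")
    case False
    then obtain x0 where x0: "x0 \<in> Q i" by blast
    then obtain y where y: "ball (g x0) \<delta> \<subseteq> V y"
      using \<delta>(2)[of "g x0"] by (auto simp: Q_def)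
    have "x \<in> U y" if x: "x \<in> Q i" for x
    proof -
      have "\<bar>(g x0 - g x) \<bullet> b\<bar> \<le> 1 / N" if b: "b \<in> Basis" for b
      proof (cases "b = e")
        case True
        then show ?thesis
          using e(2) x x0 N(1) by (simp add: inner_diff_left Q_def)
      next
        case False
        then have "cell_coordinate n N i (g x) b \<in> {0..1}" "cell_coordinate n N i (g x0) b \<in> {0..1}"
          using b x x0 by (auto simp: Q_def B_def)
        then have "\<bar>N * ((g x0 - g x) \<bullet> b)\<bar> \<le> 1"
          by (auto simp: cell_coordinate_def inner_diff_left right_diff_distrib)
        then show ?thesis
          using N(1) by (simp add: abs_mult field_simps)
      qed
      then have "(\<Sum>b\<in>Basis. \<bar>(g x0 - g x) \<bullet> b\<bar>) \<le> (\<Sum>b\<in>(Basis::'a set). 1 / N)"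
        by (rule sum_mono)
      then have "norm (g x0 - g x) \<le> real n / N"
        using norm_le_l1[of "g x0 - g x"] by (simp add: n_def)
      then have "g x \<in> ball (g x0) \<delta>"
        using N(2) by (simp add: dist_norm)
      then show ?thesis
        using y x by (auto simp: V_def Q_def)
    qed
    then show ?thesis by blast
  qed auto
  then obtain Y where Y: "\<And>i. Q i \<subseteq> U (Y i)"
    by metis
  have \<psi>0: "\<psi> i x = 0" if "x \<in> K" "x \<notin> Q i" for i x
  proof -
    have "\<not> 0 < \<psi> i x"
      using that unfolding \<psi>_def cell_bump_pos_iff[OF B(1)] by (force simp: Q_def)
    then show ?thesis
      using cell_bump_nonneg[of B n N i "g x"] by (simp add: \<psi>_def)
  qed
  have \<psi>c: "continuous_on K (\<psi> i)" for i
    unfolding \<psi>_def cell_bump_def cell_coordinate_def by (intro continuous_intros g)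
  show False
  proof (rule weighted_translations_small_multiplicity[OF K, of I \<psi> "\<lambda>i. v (Y i)"])
    show "finite I"
      unfolding I_def using B(1) by (intro finite_cartesian_product finite_PiE) auto
    fix i
    show "continuous_on K (\<psi> i)" by (rule \<psi>c)
    show "continuous_on K (\<lambda>x. \<psi> i x *\<^sub>R v (Y i) x)"
    proof -
      \<comment> \<open>The translation is continuous on the closed cell, and the weight vanishes outside of the open cell.\<close>
      have cQ: "closed (Q i)"
      proof -
        have Q_eq: "Q i = K \<inter> (\<Inter>b\<in>B. K \<inter> (\<lambda>x. cell_coordinate n N i (g x) b) -` {0..1})"
          by (auto simp: Q_def)
        have "closed (K \<inter> (\<lambda>x. cell_coordinate n N i (g x) b) -` {0..1})" for b
          unfolding cell_coordinate_def
          by (intro continuous_closed_preimage continuous_intros g compact_imp_closed K') auto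
        then show ?thesis
          unfolding Q_eq by (intro closed_Int[OF compact_imp_closed[OF K'(1)] closed_INT]) blast
      qed
      have cZ: "closed (K \<inter> \<psi> i -` {0})"
        by (intro continuous_closed_preimage \<psi>c compact_imp_closed K') auto
      have "continuous_on (Q i) (\<lambda>x. \<psi> i x *\<^sub>R v (Y i) x)"
        by (intro continuous_intros continuous_on_subset[OF \<psi>c] continuous_on_subset[OF U(4) Y])
           (auto simp: Q_def)
      moreover have "continuous_on (K \<inter> \<psi> i -` {0}) (\<lambda>x. \<psi> i x *\<^sub>R v (Y i) x)"
        by (rule continuous_on_eq[OF continuous_on_const[of _ 0]]) simp
      ultimately have "continuous_on (Q i \<union> (K \<inter> \<psi> i -` {0})) (\<lambda>x. \<psi> i x *\<^sub>R v (Y i) x)"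
        using cQ cZ by (intro continuous_on_closed_Un)
      moreover have "K = Q i \<union> (K \<inter> \<psi> i -` {0})"
      proof -
        have "Q i \<subseteq> K"
          by (auto simp: Q_def)
        then show ?thesis
          using \<psi>0[of _ i] by blast
      qed
      ultimately show ?thesis by simp
    qed
    have pos: "x \<in> U (Y i)" if "x \<in> K" "0 < \<psi> i x" for x
      using that \<psi>0[of x i] Y[of i] by auto
    show "x + v (Y i) x \<in> interior K" if "x \<in> K" "0 < \<psi> i x" for x
      using U(5) pos that by blast
    show "finite (v (Y i) ` {x\<in>K. 0 < \<psi> i x})"
      by (rule finite_subset[OF _ U(3)[of "Y i"]]) (use pos in blast)
    fix x assume x: "x \<in> K"
    show "0 \<le> \<psi> i x"
      by (simp add: \<psi>_def cell_bump_nonneg)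
    show "\<exists>i\<in>I. 0 < \<psi> i x"
      unfolding I_def \<psi>_def
    proof (rule cell_exists[OF B(1,2)])
      fix b assume "b \<in> B"
      then have "\<bar>g x \<bullet> b\<bar> \<le> D"
        using D[OF x] Basis_le_norm[of b "g x"] B(3) by force
      then have "N * \<bar>g x \<bullet> b\<bar> \<le> N * D"
        using N(1) by simp
      also have "\<dots> \<le> of_int M"
        unfolding M_def by (rule le_of_int_ceiling)
      finally show "\<bar>N * (g x \<bullet> b)\<bar> \<le> of_int M"
        using N(1) by (simp add: abs_mult)
    qed
    show "card {i\<in>I. 0 < \<psi> i x} \<le> DIM('a)"
      unfolding I_def \<psi>_def n_def[symmetric] by (rule cell_multiplicity[OF B(1)])
  qed
qed

section \<open>A fibre of large content\<close>

text \<open>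
Maps into \<open>(n-1)\<close>-space are regarded as maps into the hyperplane orthogonal to a basis vector \<open>e\<close>, with the same fibres.  A component of a
fibre has at most the content of the fibre, so it can be translated into the interior if the fibre is short.
\<close>

lemma fiber_of_large_content:
  fixes K :: "'a::euclidean_space set"
  assumes K: "convex_body K" and \<nu>: "length_content \<nu>"
    and f: "f \<in> continuous_maps_to K (DIM('a) - 1)"
  shows "\<exists>y \<in> topspace (Euclidean_space (DIM('a) - 1)). ennreal (min_width K) \<le> \<nu> (fiber K f y)"
proof (rule ccontr)
  assume "\<not> ?thesis"
  then have short: "\<nu> (fiber K f y) < ennreal (min_width K)"
    if "y \<in> topspace (Euclidean_space (DIM('a) - 1))" for y
    using that by (auto simp: not_le)
  have K': "compact K" "convex K" "K \<noteq> {}"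
    using K interior_subset by (auto simp: convex_body_def)
  define k where "k = DIM('a) - 1"
  have fc: "continuous_map (top_of_set K) (Euclidean_space k) f"
    using f by (simp add: continuous_maps_to_def k_def)
  then have ftop: "f x \<in> topspace (Euclidean_space k)" if "x \<in> K" for x
    using that continuous_map_image_subset_topspace by fastforce
  have fi: "continuous_on K (\<lambda>x. f x i)" for i
    using fc unfolding Euclidean_space_def continuous_map_in_subtopology
      continuous_map_componentwise_UNIV by simp
  obtain e :: 'a where e: "e \<in> Basis"
    using nonempty_Basis by blast
  have "card (Basis - {e}) = k"
    using e by (simp add: k_def)
  then obtain b where b: "bij_betw b {..<k} (Basis - {e})"
    using ex_bij_betw_nat_finite[of "Basis - {e}"] by (auto simp: atLeast0LessThan)
  have bB: "b i \<in> Basis" "b i \<noteq> e" if "i < k" for i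
    using b that by (auto simp: bij_betw_def)
  have binj: "b i = b j \<longleftrightarrow> i = j" if "i < k" "j < k" for i j
    using b that by (auto simp: bij_betw_def inj_on_def)
  define g where "g x = (\<Sum>i<k. f x i *\<^sub>R b i)" for x
  have gb: "g x \<bullet> b j = f x j" if "j < k" for x j
  proof -
    have "g x \<bullet> b j = (\<Sum>i<k. if i = j then f x i else 0)"
      unfolding g_def inner_sum_left
      by (intro sum.cong) (use bB binj that in \<open>auto simp: inner_Basis\<close>)
    then show ?thesis
      using that by simp
  qed
  have ge: "g x \<bullet> e = 0" for x
    unfolding g_def inner_sum_left by (rule sum.neutral) (use bB e in \<open>auto simp: inner_Basis\<close>)
  have gc: "continuous_on K g"
    unfolding g_def by (intro continuous_intros fi)
  have fib: "K \<inter> g -` {g x} = fiber K f (f x)" if "x \<in> K" for x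
  proof -
    have "f z = f x" if "z \<in> K" "g z = g x" for z
    proof
      fix i
      show "f z i = f x i"
        using gb[of i x] gb[of i z] ftop[OF \<open>z \<in> K\<close>] ftop[OF \<open>x \<in> K\<close>] \<open>g z = g x\<close>
        by (cases "i < k") (auto simp: topspace_Euclidean_space)
    qed
    moreover have "g z = g x" if "f z = f x" for z
      using that by (simp add: g_def)
    ultimately show ?thesis
      unfolding fiber_def by blast
  qed
  show False
  proof (rule fibers_not_all_piecewise_shiftable[OF K gc e ge])
    fix y
    show "piecewise_shiftable (interior K) (K \<inter> g -` {y})"
    proof (rule piecewise_shiftable_of_components)
      show F: "compact (K \<inter> g -` {y})"
      proof -
        have "closed (K \<inter> g -` {y})"
          by (intro continuous_closed_preimage gc compact_imp_closed K') auto
        then have "compact (K \<inter> (K \<inter> g -` {y}))"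
          by (intro compact_Int_closed K')
        then show ?thesis by simp
      qed
      fix C assume C: "C \<in> components (K \<inter> g -` {y})"
      then obtain x where x: "x \<in> C"
        using in_components_nonempty by blast
      have sub: "C \<subseteq> K \<inter> g -` {y}"
        using C by (rule in_components_subset)
      have "x \<in> K" "g x = y"
        using sub x by auto
      then have "K \<inter> g -` {y} = fiber K f (f x)"
        using fib[of x] by simp
      then have "\<nu> C \<le> \<nu> (fiber K f (f x))"
        using sub length_content_mono[OF \<nu>] by simp
      also have "\<dots> < ennreal (min_width K)"
        using ftop[OF \<open>x \<in> K\<close>] by (intro short) (simp add: k_def)
      finally show "\<exists>v. \<forall>x\<in>C. x + v \<in> interior K"
        using short_continuum_translates_into_interior[OF K \<nu> compact_components[OF F C]
            in_components_connected[OF C]] by metis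
    qed simp
  qed
qed

section \<open>Hausdorff measure\<close>

lemma hausdorff1_pre_antimono:
  assumes "\<delta> \<le> \<delta>'"
  shows "hausdorff1_pre \<delta>' A \<le> hausdorff1_pre \<delta> A"
  unfolding hausdorff1_pre_def
  by (rule INF_superset_mono) (use assms in \<open>auto intro: order_trans\<close>)

lemma hausdorff1_mono:
  assumes "A \<subseteq> B"
  shows "hausdorff1 A \<le> hausdorff1 B"
  unfolding hausdorff1_def hausdorff1_pre_def
proof (rule SUP_mono', rule INF_superset_mono)
  fix \<delta>
  show "{C. B \<subseteq> (\<Union>i. C i) \<and> (\<forall>i. bounded (C i) \<and> diameter (C i) \<le> \<delta>)}
      \<subseteq> {C. A \<subseteq> (\<Union>i. C i) \<and> (\<forall>i. bounded (C i) \<and> diameter (C i) \<le> \<delta>)}"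
    using assms by auto
qed simp

text \<open>
The distance from \<open>p\<close> does not increase diameters, and it maps \<open>C\<close> onto a set that contains the interval from \<open>0\<close> to
\<open>dist p q\<close>; so the bound reduces to the subadditivity of Lebesgue measure on the line.
\<close>

lemma hausdorff1_pre_connected:
  fixes C :: "'a::metric_space set"
  assumes C: "connected C" "p \<in> C" "q \<in> C"
  shows "ennreal (dist p q) \<le> hausdorff1_pre \<delta> C"
  unfolding hausdorff1_pre_def
proof (rule INF_greatest)
  fix D :: "nat \<Rightarrow> 'a set"
  assume "D \<in> {D. C \<subseteq> (\<Union>i. D i) \<and> (\<forall>i. bounded (D i) \<and> diameter (D i) \<le> \<delta>)}"
  then have D: "C \<subseteq> (\<Union>i. D i)" "\<And>i. bounded (D i)"
    by auto
  \<comment> \<open>The interval starts at the least distance; one centred at a point of \<open>D i\<close> would be twice as long.\<close>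
  define J where "J i = {Inf (dist p ` D i)..Inf (dist p ` D i) + diameter (D i)}" for i
  have "dist p x \<in> J i" if x: "x \<in> D i" for x i
  proof -
    have bdd: "bdd_below (dist p ` D i)"
      by (rule bdd_belowI[of _ 0]) auto
    have "dist p x - diameter (D i) \<le> Inf (dist p ` D i)"
    proof (rule cInf_greatest)
      fix s assume "s \<in> dist p ` D i"
      then obtain y where y: "y \<in> D i" "s = dist p y" by blast
      have "dist p x \<le> dist p y + dist x y"
        by (metis dist_commute dist_triangle)
      with diameter_bounded_bound[OF D(2) x y(1)] y(2)
      show "dist p x - diameter (D i) \<le> s" by simp
    qed (use x in auto)
    then show ?thesis
      using cInf_lower[OF imageI[OF x] bdd] by (simp add: J_def)
  qed
  then have J: "\<And>x i. x \<in> D i \<Longrightarrow> dist p x \<in> J i" .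
  have sub: "dist p ` C \<subseteq> (\<Union>i. J i)"
  proof
    fix s assume "s \<in> dist p ` C"
    then obtain x where "x \<in> C" "s = dist p x" by blast
    moreover from this D(1) obtain i where "x \<in> D i" by blast
    ultimately show "s \<in> (\<Union>i. J i)"
      using J by blast
  qed
  have "connected (dist p ` C)"
    by (intro connected_continuous_image continuous_intros C)
  moreover have "0 \<in> dist p ` C" "dist p q \<in> dist p ` C"
    using imageI[OF C(2), of "dist p"] imageI[OF C(3), of "dist p"] by simp_all
  ultimately have "{0..dist p q} \<subseteq> dist p ` C"
    by (meson connected_contains_Icc)
  then have "ennreal (dist p q) \<le> emeasure lborel (\<Union>i. J i)"
  proof -
    assume I: "{0..dist p q} \<subseteq> dist p ` C"
    have "emeasure lborel {0..dist p q} \<le> emeasure lborel (\<Union>i. J i)"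
      using I sub by (intro emeasure_mono) (auto simp: J_def)
    then show ?thesis by simp
  qed
  also have "\<dots> \<le> (\<Sum>i. emeasure lborel (J i))"
    by (rule emeasure_subadditive_countably) (auto simp: J_def)
  also have "\<dots> = (\<Sum>i. ennreal (diameter (D i)))"
    using diameter_ge_0[OF D(2)] by (simp add: J_def)
  finally show "ennreal (dist p q) \<le> (\<Sum>i. ennreal (diameter (D i)))" .
qed

text \<open>
No covering set of diameter at most \<open>\<delta>\<close> meets both sets, so that every covering splits into two.
\<close>

lemma hausdorff1_pre_separated:
  fixes A B :: "'a::metric_space set"
  assumes sep: "\<And>a b. a \<in> A \<Longrightarrow> b \<in> B \<Longrightarrow> \<delta> < dist a b"
  shows "hausdorff1_pre \<delta> A + hausdorff1_pre \<delta> B \<le> hausdorff1_pre \<delta> (A \<union> B)"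
  unfolding hausdorff1_pre_def[of \<delta> "A \<union> B"]
proof (rule INF_greatest)
  fix D :: "nat \<Rightarrow> 'a set"
  assume "D \<in> {D. A \<union> B \<subseteq> (\<Union>i. D i) \<and> (\<forall>i. bounded (D i) \<and> diameter (D i) \<le> \<delta>)}"
  then have D: "A \<union> B \<subseteq> (\<Union>i. D i)" "\<And>i. bounded (D i)" "\<And>i. diameter (D i) \<le> \<delta>"
    by auto
  have \<delta>: "0 \<le> \<delta>"
    using diameter_ge_0[OF D(2)] D(3) by (rule order_trans)
  define E where "E i = (if D i \<inter> A = {} then {} else D i)" for i
  define F where "F i = (if D i \<inter> A = {} then D i else {})" for i
  have noB: "D i \<inter> B = {}" if "D i \<inter> A \<noteq> {}" for i
  proof (rule ccontr)
    assume "D i \<inter> B \<noteq> {}"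
    with that obtain a b where ab: "a \<in> D i" "a \<in> A" "b \<in> D i" "b \<in> B" by blast
    have "dist a b \<le> \<delta>"
      using diameter_bounded_bound[OF D(2) ab(1,3)] D(3) by (rule order_trans)
    with sep[OF ab(2,4)] show False by simp
  qed
  have "hausdorff1_pre \<delta> A \<le> (\<Sum>i. ennreal (diameter (E i)))"
    unfolding hausdorff1_pre_def
  proof (rule INF_lower, safe)
    fix x assume x: "x \<in> A"
    then obtain i where "x \<in> D i" using D(1) by blast
    with x show "x \<in> (\<Union>i. E i)" by (auto simp: E_def)
  qed (use D \<delta> in \<open>auto simp: E_def\<close>)
  moreover have "hausdorff1_pre \<delta> B \<le> (\<Sum>i. ennreal (diameter (F i)))"
    unfolding hausdorff1_pre_def
  proof (rule INF_lower, safe)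
    fix x assume x: "x \<in> B"
    then obtain i where i: "x \<in> D i" using D(1) by blast
    with x noB[of i] have "x \<in> F i" by (auto simp: F_def)
    then show "x \<in> (\<Union>i. F i)" by blast
  qed (use D \<delta> in \<open>auto simp: F_def\<close>)
  ultimately have "hausdorff1_pre \<delta> A + hausdorff1_pre \<delta> B \<le>
      (\<Sum>i. ennreal (diameter (E i))) + (\<Sum>i. ennreal (diameter (F i)))"
    by (rule add_mono)
  also have "\<dots> = (\<Sum>i. ennreal (diameter (E i)) + ennreal (diameter (F i)))"
    by (rule suminf_add) auto
  also have "\<dots> = (\<Sum>i. ennreal (diameter (D i)))"
    by (rule arg_cong[of _ _ suminf]) (auto simp: E_def F_def fun_eq_iff)
  finally show "hausdorff1_pre \<delta> A + hausdorff1_pre \<delta> B \<le> (\<Sum>i. ennreal (diameter (D i)))" .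
qed

lemma hausdorff1_superadditive:
  fixes A B :: "'a::euclidean_space set"
  assumes AB: "compact A" "compact B" "A \<inter> B = {}"
  shows "hausdorff1 A + hausdorff1 B \<le> hausdorff1 (A \<union> B)"
proof -
  obtain d where d: "d > 0" "\<And>a b. a \<in> A \<Longrightarrow> b \<in> B \<Longrightarrow> d \<le> dist a b"
    using separate_compact_closed[OF AB(1) compact_imp_closed[OF AB(2)] AB(3)] by auto
  have "hausdorff1 A + hausdorff1 B = (SUP \<delta>\<in>{0<..}. hausdorff1_pre \<delta> A + hausdorff1_pre \<delta> B)"
    unfolding hausdorff1_def
  proof (rule SUP_add_directed_ennreal[symmetric])
    fix i j :: real assume "i \<in> {0<..}" "j \<in> {0<..}"
    then show "\<exists>k\<in>{0<..}. hausdorff1_pre i A + hausdorff1_pre j B \<le> hausdorff1_pre k A + hausdorff1_pre k B"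
      by (intro bexI[of _ "min i j"] add_mono hausdorff1_pre_antimono) auto
  qed
  also have "\<dots> \<le> hausdorff1 (A \<union> B)"
  proof (rule SUP_least)
    fix \<delta> :: real assume \<delta>: "\<delta> \<in> {0<..}"
    define \<epsilon> where "\<epsilon> = min \<delta> (d / 2)"
    have \<epsilon>: "0 < \<epsilon>" "\<epsilon> \<le> \<delta>" "\<epsilon> < d"
      using \<delta> d(1) by (auto simp: \<epsilon>_def min_def)
    have "hausdorff1_pre \<delta> A + hausdorff1_pre \<delta> B \<le> hausdorff1_pre \<epsilon> A + hausdorff1_pre \<epsilon> B"
      by (intro add_mono hausdorff1_pre_antimono \<epsilon>)
    also have "\<dots> \<le> hausdorff1_pre \<epsilon> (A \<union> B)"
      using d(2) \<epsilon>(3) by (intro hausdorff1_pre_separated) (meson less_le_trans)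
    also have "\<dots> \<le> hausdorff1 (A \<union> B)"
      unfolding hausdorff1_def using \<epsilon>(1) by (intro SUP_upper) auto
    finally show "hausdorff1_pre \<delta> A + hausdorff1_pre \<delta> B \<le> hausdorff1 (A \<union> B)" .
  qed
  finally show ?thesis .
qed

lemma length_content_hausdorff1:
  "length_content (hausdorff1 :: 'a::euclidean_space set \<Rightarrow> ennreal)"
  unfolding length_content_def
proof (intro conjI allI impI)
  fix A B :: "'a set" assume "A \<subseteq> B"
  then show "hausdorff1 A \<le> hausdorff1 B" by (rule hausdorff1_mono)
next
  fix C :: "'a set" and p q assume C: "connected C" "p \<in> C" "q \<in> C"
  have "ennreal (dist p q) \<le> hausdorff1_pre 1 C"
    by (rule hausdorff1_pre_connected[OF C])
  also have "\<dots> \<le> hausdorff1 C"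
    unfolding hausdorff1_def by (rule SUP_upper) auto
  finally show "ennreal (dist p q) \<le> hausdorff1 C" .
next
  fix A B :: "'a set" assume "compact A" "compact B" "A \<inter> B = {}"
  then show "hausdorff1 A + hausdorff1 B \<le> hausdorff1 (A \<union> B)"
    by (rule hausdorff1_superadditive)
qed

text \<open>
A set whose points are aligned in the direction \<open>u\<close> is cut into \<open>n\<close> slices of diameter at most \<open>l / n\<close>.
\<close>

lemma hausdorff1_thin_le:
  fixes Z :: "'a::euclidean_space set"
  assumes Z: "bounded Z" and l: "0 \<le> l"
    and u: "\<And>x y. x \<in> Z \<Longrightarrow> y \<in> Z \<Longrightarrow> dist x y \<le> \<bar>u \<bullet> x - u \<bullet> y\<bar>"
      "\<And>x y. x \<in> Z \<Longrightarrow> y \<in> Z \<Longrightarrow> \<bar>u \<bullet> x - u \<bullet> y\<bar> \<le> l"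
  shows "hausdorff1 Z \<le> ennreal l"
proof (cases "Z = {}")
  case True
  have "hausdorff1_pre \<delta> ({} :: 'a set) \<le> ennreal l" if "0 < \<delta>" for \<delta>
  proof -
    have "hausdorff1_pre \<delta> ({} :: 'a set) \<le> (\<Sum>i. ennreal (diameter ((\<lambda>_. {}) (i::nat) :: 'a set)))"
      unfolding hausdorff1_pre_def by (rule INF_lower) (use that in auto)
    then show ?thesis by simp
  qed
  then show ?thesis
    unfolding hausdorff1_def True by (intro SUP_least) simp
next
  case False
  define a where "a = Inf ((\<lambda>x. u \<bullet> x) ` Z)"
  obtain x0 where x0: "x0 \<in> Z" using False by blast
  have bdd: "bdd_below ((\<lambda>x. u \<bullet> x) ` Z)"
  proof (rule bdd_belowI2)
    fix x assume "x \<in> Z"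
    then show "u \<bullet> x0 - l \<le> u \<bullet> x"
      using u(2)[OF x0, of x] by (simp add: abs_le_iff)
  qed
  have a: "0 \<le> u \<bullet> x - a" "u \<bullet> x - a \<le> l" if x: "x \<in> Z" for x
  proof -
    have "a \<le> u \<bullet> x"
      unfolding a_def using x bdd by (intro cInf_lower) auto
    then show "0 \<le> u \<bullet> x - a" by simp
    have "u \<bullet> x - l \<le> a"
      unfolding a_def
    proof (rule cInf_greatest)
      fix s assume "s \<in> (\<lambda>x. u \<bullet> x) ` Z"
      then obtain y where "y \<in> Z" "s = u \<bullet> y" by blast
      then show "u \<bullet> x - l \<le> s"
        using u(2)[OF x, of y] by (simp add: abs_le_iff)
    qed (use False in auto)
    then show "u \<bullet> x - a \<le> l" by simp
  qed
  show ?thesis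
    unfolding hausdorff1_def
  proof (rule SUP_least)
    fix \<delta> :: real assume "\<delta> \<in> {0<..}"
    then have \<delta>: "0 < \<delta>" by simp
    obtain n :: nat where n: "l / \<delta> < real n"
      using reals_Archimedean2 by blast
    have n0: "0 < n"
      using n l \<delta> by (intro gr0I) (auto simp: divide_less_0_iff)
    have ln: "l / real n \<le> \<delta>"
      using n n0 \<delta> by (simp add: field_simps)
    define D where "D i = (if i < n then {x\<in>Z. l * real i / real n \<le> u \<bullet> x - a \<and> u \<bullet> x - a \<le> l * real (Suc i) / real n} else {})" for i
    have diam: "diameter (D i) \<le> (if i < n then l / real n else 0)" for i
    proof (cases "i < n")
      case True
      have "norm (x - y) \<le> l / real n" if "x \<in> D i" "y \<in> D i" for x y
      proof -
        have "x \<in> Z" "y \<in> Z"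
          using that True by (auto simp: D_def)
        then have "dist x y \<le> \<bar>u \<bullet> x - u \<bullet> y\<bar>"
          by (rule u(1))
        also have "\<dots> \<le> l * real (Suc i) / real n - l * real i / real n"
          using that True by (auto simp: D_def)
        also have "\<dots> = l / real n"
          by (simp add: distrib_left add_divide_distrib)
        finally show ?thesis by (simp add: dist_norm)
      qed
      then show ?thesis
        using True l by (simp add: diameter_le)
    qed (simp add: D_def)
    have cover: "Z \<subseteq> (\<Union>i. D i)"
    proof
      fix x assume x: "x \<in> Z"
      show "x \<in> (\<Union>i. D i)"
      proof (cases "u \<bullet> x - a = l")
        case True
        then have "x \<in> D (n - 1)"
          using x n0 l by (auto simp: D_def of_nat_diff field_simps)
        then show ?thesis by blast
      next
        case False
        then have lt: "u \<bullet> x - a < l" and lpos: "0 < l"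
          using a[OF x] by auto
        define r where "r = (u \<bullet> x - a) * real n / l"
        have "(u \<bullet> x - a) * real n < real n * l"
          using lt n0 by (simp add: mult.commute)
        then have r: "0 \<le> r" "r < real n"
          using a[OF x] lpos by (auto simp: r_def pos_divide_less_eq)
        define i where "i = nat \<lfloor>r\<rfloor>"
        have i: "real i \<le> r" "r \<le> real (Suc i)" "i < n"
          using r unfolding i_def by linarith+
        have eq: "u \<bullet> x - a = l * r / real n"
          using lpos n0 by (simp add: r_def)
        have "x \<in> D i"
          using x i lpos n0 by (auto simp: D_def eq intro!: divide_right_mono mult_left_mono)
        then show ?thesis by blast
      qed
    qed
    have "hausdorff1_pre \<delta> Z \<le> (\<Sum>i. ennreal (diameter (D i)))"
      unfolding hausdorff1_pre_def
    proof (rule INF_lower, intro CollectI conjI allI)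
      show "Z \<subseteq> (\<Union>i. D i)" by (rule cover)
      show "bounded (D i)" for i
        by (rule bounded_subset[OF Z]) (auto simp: D_def)
      show "diameter (D i) \<le> \<delta>" for i
        using diam[of i] ln \<delta> by (auto split: if_splits)
    qed
    also have "\<dots> = (\<Sum>i<n. ennreal (diameter (D i)))"
      by (rule suminf_finite) (auto simp: D_def)
    also have "\<dots> \<le> (\<Sum>i<n. ennreal (l / real n))"
      using diam by (intro sum_mono ennreal_leI) (metis lessThan_iff)
    also have "\<dots> = ennreal l"
      using n0 l by (simp add: ennreal_of_nat_eq_real_of_nat flip: ennreal_mult)
    finally show "hausdorff1_pre \<delta> Z \<le> ennreal l" .
  qed
qed

section \<open>Slices of Lebesgue measure\<close>

text \<open>
The reflection in the hyperplane orthogonal to \<open>u - e\<close>.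
\<close>

lemma reflection_swapping:
  fixes u e :: "'a::euclidean_space"
  assumes u: "norm u = 1" and e: "norm e = 1"
  obtains R where "orthogonal_transformation R" "R u = e" "\<And>x. R (R x) = x"
proof (cases "u = e")
  case True
  then show thesis
    using that[of "\<lambda>x. x"] by simp
next
  case False
  define v where "v = u - e"
  have v0: "v \<bullet> v \<noteq> 0"
    using False by (simp add: v_def)
  define R where "R x = x - (2 * (x \<bullet> v) / (v \<bullet> v)) *\<^sub>R v" for x
  have Rv: "R x \<bullet> v = - (x \<bullet> v)" for x
    using v0 by (simp add: R_def inner_diff_left)
  have RR: "R (R x) = x" for x
    unfolding R_def[of "R x"] Rv by (simp add: R_def)
  have "linear R"
    unfolding R_def
    by (intro linearI) (auto simp: inner_add_left add_divide_distrib distrib_left scaleR_add_left algebra_simps)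
  moreover have "norm (R x) = norm x" for x
  proof -
    have "R x \<bullet> R x = R x \<bullet> x - (2 * (x \<bullet> v) / (v \<bullet> v)) * (R x \<bullet> v)"
      by (subst (2) R_def) (simp add: inner_diff_right)
    also have "R x \<bullet> x = x \<bullet> x - (2 * (x \<bullet> v) / (v \<bullet> v)) * (x \<bullet> v)"
      unfolding R_def[of x] by (simp only: inner_diff_left inner_scaleR_left inner_commute[of v x])
    also have "\<dots> - (2 * (x \<bullet> v) / (v \<bullet> v)) * (R x \<bullet> v) = x \<bullet> x"
      unfolding Rv by simp
    finally show ?thesis
      by (simp add: norm_eq_sqrt_inner)
  qed
  ultimately have "orthogonal_transformation R"
    by (simp add: orthogonal_transformation)
  moreover have "R u = e"
  proof -
    have uu: "u \<bullet> u = 1" "e \<bullet> e = 1"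
      using u e by (simp_all add: norm_eq_1)
    then have "v \<bullet> v = 2 * (u \<bullet> v)"
      by (simp add: v_def inner_diff_left inner_diff_right inner_commute)
    then show ?thesis
      using v0 by (simp add: R_def v_def)
  qed
  ultimately show thesis
    using that RR by blast
qed

lemma nn_integral_lborel_translate:
  fixes f :: "'a::euclidean_space \<Rightarrow> ennreal"
  assumes [measurable]: "f \<in> borel_measurable borel"
  shows "(\<integral>\<^sup>+x. f (c + x) \<partial>lborel) = (\<integral>\<^sup>+x. f x \<partial>lborel)"
proof -
  have "(\<integral>\<^sup>+x. f x \<partial>lborel) = (\<integral>\<^sup>+x. f x \<partial>distr lborel borel ((+) c))"
    by (simp add: lborel_distr_plus)
  also have "\<dots> = (\<integral>\<^sup>+x. f (c + x) \<partial>lborel)"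
    by (rule nn_integral_distr) auto
  finally show ?thesis ..
qed

text \<open>
The uniqueness argument for translation invariant measures.  With the unit ball \<open>B\<close>, which is invariant
under \<open>R\<close>, the integral of \<open>indicator B y * indicator A (R x + y)\<close> over all pairs \<open>(x, y)\<close> is evaluated in two
ways: integration over \<open>x\<close> first gives the measure of \<open>B\<close> times that of the preimage of \<open>A\<close>, and integration
over \<open>y\<close> first, after the substitution of \<open>y - R x\<close> for \<open>y\<close>, gives the measure of \<open>B\<close> times that of \<open>A\<close>.
\<close>

lemma emeasure_lborel_orthogonal:
  fixes R :: "'a::euclidean_space \<Rightarrow> 'a"
  assumes R: "orthogonal_transformation R" and A: "A \<in> sets borel"
  shows "emeasure lborel (R -` A) = emeasure lborel A"
proof -
  have lin: "linear R"
    using R by (rule orthogonal_transformation_linear)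
  have [measurable]: "R \<in> borel_measurable borel"
    using lin by (intro borel_measurable_continuous_onI linear_continuous_on) (simp add: linear_conv_bounded_linear)
  note [measurable] = A
  define B where "B = ball (0::'a) 1"
  have [measurable]: "B \<in> sets borel"
    by (simp add: B_def)
  have RA: "R -` A \<in> sets borel"
    using measurable_sets[of R borel borel A] A by simp
  define b where "b = emeasure lborel B"
  have "unit_ball_vol (real DIM('a)) \<noteq> 0"
    by (rule less_imp_neq[symmetric, OF unit_ball_vol_pos]) simp
  then have b: "b \<noteq> 0" "b \<noteq> top"
    by (simp_all add: b_def B_def emeasure_ball)
  have surj: "\<exists>z. R z = y" for y
    using orthogonal_transformation_surj[OF R] unfolding surj_def by metis
  have "b * emeasure lborel (R -` A) = (\<integral>\<^sup>+y. indicator B y * emeasure lborel (R -` A) \<partial>lborel)"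
    by (simp add: nn_integral_multc b_def)
  also have "\<dots> = (\<integral>\<^sup>+y. (\<integral>\<^sup>+x. indicator B y * indicator A (R x + y) \<partial>lborel) \<partial>lborel)"
  proof (rule nn_integral_cong)
    fix y
    obtain z where z: "R z = y" using surj by blast
    have "emeasure lborel (R -` A) = (\<integral>\<^sup>+x. indicator A (R x) \<partial>lborel)"
      using RA by (simp add: nn_integral_indicator[symmetric] indicator_vimage[symmetric] del: nn_integral_indicator)
    also have "\<dots> = (\<integral>\<^sup>+x. indicator A (R (z + x)) \<partial>lborel)"
      by (rule nn_integral_lborel_translate[symmetric]) measurable
    also have "\<dots> = (\<integral>\<^sup>+x. indicator A (R x + y) \<partial>lborel)"
      by (simp add: linear_add[OF lin] z add.commute)
    finally show "indicator B y * emeasure lborel (R -` A) = (\<integral>\<^sup>+x. indicator B y * indicator A (R x + y) \<partial>lborel)"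
      by (simp add: nn_integral_cmult)
  qed
  also have "\<dots> = (\<integral>\<^sup>+x. (\<integral>\<^sup>+y. indicator B y * indicator A (R x + y) \<partial>lborel) \<partial>lborel)"
    by (rule lborel_pair.Fubini') measurable
  also have "\<dots> = (\<integral>\<^sup>+x. (\<integral>\<^sup>+y. indicator B (y - R x) * indicator A y \<partial>lborel) \<partial>lborel)"
  proof (rule nn_integral_cong)
    fix x
    have "(\<integral>\<^sup>+y. indicator B y * indicator A (R x + y) \<partial>lborel)
        = (\<integral>\<^sup>+y. (\<lambda>y. indicator B (y - R x) * indicator A y) (R x + y) \<partial>lborel)"
      by simp
    also have "\<dots> = (\<integral>\<^sup>+y. indicator B (y - R x) * indicator A y \<partial>lborel)"
      by (rule nn_integral_lborel_translate) measurable
    finally show "(\<integral>\<^sup>+y. indicator B y * indicator A (R x + y) \<partial>lborel)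
        = (\<integral>\<^sup>+y. indicator B (y - R x) * indicator A y \<partial>lborel)" .
  qed
  also have "\<dots> = (\<integral>\<^sup>+y. (\<integral>\<^sup>+x. indicator B (y - R x) * indicator A y \<partial>lborel) \<partial>lborel)"
    by (rule lborel_pair.Fubini'[symmetric]) measurable
  also have "\<dots> = (\<integral>\<^sup>+y. b * indicator A y \<partial>lborel)"
  proof (rule nn_integral_cong)
    fix y
    obtain z where z: "R z = y" using surj by blast
    have "y - R x \<in> B \<longleftrightarrow> x \<in> ball z 1" for x
    proof -
      have "y - R x = R (z - x)"
        by (simp add: linear_diff[OF lin] z)
      then show ?thesis
        by (simp add: B_def orthogonal_transformation_norm[OF R] dist_norm)
    qed
    then have "(\<integral>\<^sup>+x. indicator B (y - R x) * indicator A y \<partial>lborel)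
        = (\<integral>\<^sup>+x. indicator (ball z 1) x * indicator A y \<partial>lborel)"
      by (intro nn_integral_cong) (simp add: indicator_def)
    also have "\<dots> = emeasure lborel (ball z 1) * indicator A y"
    proof (subst nn_integral_multc)
      show "indicator (ball z 1) \<in> borel_measurable lborel"
        by (intro borel_measurable_indicator) simp
    qed simp
    also have "emeasure lborel (ball z 1) = b"
      by (simp add: b_def B_def emeasure_ball)
    finally show "(\<integral>\<^sup>+x. indicator B (y - R x) * indicator A y \<partial>lborel) = b * indicator A y" .
  qed
  also have "\<dots> = b * emeasure lborel A"
    by (simp add: nn_integral_cmult)
  finally show ?thesis
    using b by (simp add: ennreal_mult_cancel_left)
qed

text \<open>
The point at height \<open>y\<close> over the axis \<open>e\<close> whose other coordinates are given by \<open>f\<close>.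
\<close>

definition slice_point :: "'a::euclidean_space \<Rightarrow> real \<Rightarrow> ('a \<Rightarrow> real) \<Rightarrow> 'a" where
  "slice_point e y f = y *\<^sub>R e + (\<Sum>b\<in>Basis - {e}. f b *\<^sub>R b)"

lemma slice_point_diff_norm:
  assumes e: "e \<in> Basis"
  shows "norm (slice_point e (c \<bullet> e) f - c) = sqrt (\<Sum>b\<in>Basis - {e}. (f b - c \<bullet> b)\<^sup>2)"
proof -
  have comp: "(slice_point e (c \<bullet> e) f - c) \<bullet> b = (if b = e then 0 else f b - c \<bullet> b)" if b: "b \<in> Basis" for b
  proof -
    have "(\<Sum>i\<in>Basis - {e}. f i * (i \<bullet> b)) = (\<Sum>i\<in>Basis - {e}. if i = b then f i else 0)"
      by (rule sum.cong) (use b in \<open>auto simp: inner_Basis\<close>)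
    also have "\<dots> = (if b = e then 0 else f b)"
      using b by (simp add: sum.delta)
    finally show ?thesis
      using b e by (simp add: slice_point_def inner_diff_left inner_add_left inner_sum_left inner_Basis)
  qed
  have "norm (slice_point e (c \<bullet> e) f - c) = sqrt (\<Sum>b\<in>Basis. ((slice_point e (c \<bullet> e) f - c) \<bullet> b)\<^sup>2)"
    unfolding norm_eq_sqrt_inner by (subst euclidean_inner) (simp only: power2_eq_square)
  also have "(\<Sum>b\<in>Basis. ((slice_point e (c \<bullet> e) f - c) \<bullet> b)\<^sup>2) = (\<Sum>b\<in>Basis. (if b = e then 0 else f b - c \<bullet> b)\<^sup>2)"
    by (rule sum.cong) (use comp in auto)
  also have "\<dots> = (\<Sum>b\<in>Basis - {e}. (f b - c \<bullet> b)\<^sup>2)"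
    by (subst sum.remove[OF finite_Basis e]) auto
  finally show ?thesis .
qed

lemma slice_point_measurable:
  "slice_point e y \<in> measurable (PiM (Basis - {e}) (\<lambda>_. lborel)) borel"
  unfolding slice_point_def by measurable

lemma emeasure_lborel_slices:
  fixes A :: "'a::euclidean_space set"
  assumes A: "A \<in> sets borel" and e: "e \<in> Basis"
  shows "emeasure lborel A =
    (\<integral>\<^sup>+y. emeasure (PiM (Basis - {e}) (\<lambda>_. lborel)) (slice_point e y -` A \<inter> space (PiM (Basis - {e}) (\<lambda>_. lborel))) \<partial>lborel)"
proof -
  interpret product_sigma_finite "\<lambda>_::'a. lborel :: real measure"
    by standard
  let ?B = "Basis - {e}"
  have ins: "insert e ?B = Basis"
    using e by auto
  let ?T = "\<lambda>f::'a \<Rightarrow> real. \<Sum>b\<in>Basis. f b *\<^sub>R b"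
  have T: "?T \<in> measurable (PiM Basis (\<lambda>_. lborel)) borel"
    by measurable
  have "emeasure lborel A = emeasure (distr (PiM Basis (\<lambda>_. lborel)) borel ?T) A"
    by (subst lborel_eq) simp
  also have "\<dots> = (\<integral>\<^sup>+f. indicator A (?T f) \<partial>PiM Basis (\<lambda>_. lborel))"
    using A T by (simp add: nn_integral_distr flip: nn_integral_indicator)
  also have "\<dots> = (\<integral>\<^sup>+f. indicator A (?T f) \<partial>PiM (insert e ?B) (\<lambda>_. lborel))"
    by (simp only: ins)
  also have "\<dots> = (\<integral>\<^sup>+y. (\<integral>\<^sup>+f. indicator A (?T (f(e := y))) \<partial>PiM ?B (\<lambda>_. lborel)) \<partial>lborel)"
  proof (rule product_nn_integral_insert_rev)
    show "(\<lambda>f. indicator A (?T f) :: ennreal) \<in> borel_measurable (PiM (insert e ?B) (\<lambda>_. lborel))"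
      unfolding ins using A T by measurable
  qed auto
  also have "\<dots> = (\<integral>\<^sup>+y. emeasure (PiM ?B (\<lambda>_. lborel)) (slice_point e y -` A \<inter> space (PiM ?B (\<lambda>_. lborel))) \<partial>lborel)"
  proof (rule nn_integral_cong)
    fix y
    have "?T (f(e := y)) = slice_point e y f" for f
    proof -
      have "?T (f(e := y)) = (f(e := y)) e *\<^sub>R e + (\<Sum>b\<in>?B. (f(e := y)) b *\<^sub>R b)"
        by (rule sum.remove[OF finite_Basis e])
      also have "(\<Sum>b\<in>?B. (f(e := y)) b *\<^sub>R b) = (\<Sum>b\<in>?B. f b *\<^sub>R b)"
        by (rule sum.cong) auto
      finally show ?thesis by (simp add: slice_point_def)
    qed
    then have "(\<integral>\<^sup>+f. indicator A (?T (f(e := y))) \<partial>PiM ?B (\<lambda>_. lborel))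
        = (\<integral>\<^sup>+f. indicator (slice_point e y -` A \<inter> space (PiM ?B (\<lambda>_. lborel))) f \<partial>PiM ?B (\<lambda>_. lborel))"
      by (intro nn_integral_cong) (simp add: indicator_def)
    also have "\<dots> = emeasure (PiM ?B (\<lambda>_. lborel)) (slice_point e y -` A \<inter> space (PiM ?B (\<lambda>_. lborel)))"
      by (intro nn_integral_indicator measurable_sets[OF slice_point_measurable A])
    finally show "(\<integral>\<^sup>+f. indicator A (?T (f(e := y))) \<partial>PiM ?B (\<lambda>_. lborel))
        = emeasure (PiM ?B (\<lambda>_. lborel)) (slice_point e y -` A \<inter> space (PiM ?B (\<lambda>_. lborel)))" .
  qed
  finally show ?thesis .
qed

text \<open>
The product measure is invariant under translations, so the ball may be centred at the origin.
\<close>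

lemma emeasure_PiM_ball:
  fixes c :: "'i \<Rightarrow> real"
  assumes I: "finite I" and r: "0 < r"
  shows "emeasure (PiM I (\<lambda>_. lborel)) ({f. sqrt (\<Sum>i\<in>I. (f i - c i)\<^sup>2) \<le> r} \<inter> space (PiM I (\<lambda>_. lborel)))
    = ennreal (unit_ball_vol (real (card I)) * r ^ card I)"
proof -
  interpret product_sigma_finite "\<lambda>_::'i. lborel :: real measure"
    by standard
  let ?P = "PiM I (\<lambda>_. lborel :: real measure)"
  define S where "S f = (\<lambda>i\<in>I. f i + c i)" for f :: "'i \<Rightarrow> real"
  have S: "S \<in> measurable ?P ?P"
    unfolding S_def by measurable
  have "distr ?P ?P S = ?P"
  proof (rule PiM_eqI[OF I])
    fix A :: "'i \<Rightarrow> real set" assume A: "\<And>i. i \<in> I \<Longrightarrow> A i \<in> sets lborel"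
    have "emeasure (distr ?P ?P S) (Pi\<^sub>E I A) = emeasure ?P (S -` Pi\<^sub>E I A \<inter> space ?P)"
      using A I by (intro emeasure_distr S sets_PiM_I_finite) auto
    also have "S -` Pi\<^sub>E I A \<inter> space ?P = Pi\<^sub>E I (\<lambda>i. (\<lambda>x. x + c i) -` A i)"
      by (auto simp: S_def space_PiM PiE_iff)
    also have "emeasure ?P \<dots> = (\<Prod>i\<in>I. emeasure lborel ((\<lambda>x. x + c i) -` A i))"
    proof (rule emeasure_PiM[OF I])
      fix i assume "i \<in> I"
      then show "(\<lambda>x. x + c i) -` A i \<in> sets lborel"
        using A measurable_sets[of "\<lambda>x. x + c i" borel borel "A i"] by simp
    qed
    also have "\<dots> = (\<Prod>i\<in>I. emeasure lborel (A i))"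
    proof (rule prod.cong)
      fix i assume i: "i \<in> I"
      have "emeasure lborel (A i) = emeasure (distr lborel borel ((+) (c i))) (A i)"
        by (simp add: lborel_distr_plus)
      also have "\<dots> = emeasure lborel ((+) (c i) -` A i)"
        using A[OF i] by (simp add: emeasure_distr)
      also have "(+) (c i) -` A i = (\<lambda>x. x + c i) -` A i"
        by (auto simp: add.commute)
      finally show "emeasure lborel ((\<lambda>x. x + c i) -` A i) = emeasure lborel (A i)" ..
    qed simp
    finally show "emeasure (distr ?P ?P S) (Pi\<^sub>E I A) = (\<Prod>i\<in>I. emeasure lborel (A i))" .
  qed simp
  then have "emeasure ?P ({f. sqrt (\<Sum>i\<in>I. (f i - c i)\<^sup>2) \<le> r} \<inter> space ?P)
      = emeasure (distr ?P ?P S) ({f. sqrt (\<Sum>i\<in>I. (f i - c i)\<^sup>2) \<le> r} \<inter> space ?P)"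
    by simp
  also have "\<dots> = emeasure ?P (S -` ({f. sqrt (\<Sum>i\<in>I. (f i - c i)\<^sup>2) \<le> r} \<inter> space ?P) \<inter> space ?P)"
  proof (rule emeasure_distr[OF S])
    have "{f \<in> space ?P. sqrt (\<Sum>i\<in>I. (f i - c i)\<^sup>2) \<le> r} \<in> sets ?P"
      by measurable
    also have "{f \<in> space ?P. sqrt (\<Sum>i\<in>I. (f i - c i)\<^sup>2) \<le> r} = {f. sqrt (\<Sum>i\<in>I. (f i - c i)\<^sup>2) \<le> r} \<inter> space ?P"
      by auto
    finally show "{f. sqrt (\<Sum>i\<in>I. (f i - c i)\<^sup>2) \<le> r} \<inter> space ?P \<in> sets ?P" .
  qed
  also have "S -` ({f. sqrt (\<Sum>i\<in>I. (f i - c i)\<^sup>2) \<le> r} \<inter> space ?P) \<inter> space ?P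
      = {f. sqrt (\<Sum>i\<in>I. (f i)\<^sup>2) \<le> r} \<inter> space ?P"
    by (auto simp: S_def space_PiM)
  also have "emeasure ?P \<dots> = ennreal (unit_ball_vol (real (card I)) * r ^ card I)"
    by (rule emeasure_cball_aux[OF I r])
  finally show ?thesis .
qed

section \<open>Lower Minkowski content\<close>

lemma open_nbhd_eq_UN: "open_nbhd t Z = (\<Union>z\<in>Z. ball z t)"
  by (auto simp: open_nbhd_def dist_commute)

lemma open_open_nbhd: "open (open_nbhd t Z)"
  unfolding open_nbhd_eq_UN by (intro open_UN ballI open_ball)

lemma open_nbhd_orthogonal:
  fixes R :: "'a::euclidean_space \<Rightarrow> 'a"
  assumes R: "orthogonal_transformation R"
  shows "R -` open_nbhd t (R ` Z) = open_nbhd t Z"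
proof -
  have "dist (R x) (R y) = dist x y" for x y
    using orthogonal_transformation_norm[OF R, of "x - y"] linear_diff[OF orthogonal_transformation_linear[OF R]]
    by (simp add: dist_norm)
  then show ?thesis
    by (auto simp: open_nbhd_def)
qed

lemma emeasure_open_nbhd_orthogonal:
  fixes R :: "'a::euclidean_space \<Rightarrow> 'a"
  assumes R: "orthogonal_transformation R"
  shows "emeasure lborel (open_nbhd t (R ` Z)) = emeasure lborel (open_nbhd t Z)"
  using emeasure_lborel_orthogonal[OF R, of "open_nbhd t (R ` Z)"] open_open_nbhd[of t "R ` Z"]
  by (simp add: open_nbhd_orthogonal[OF R])

lemma slice_of_nbhd_contains_ball:
  fixes c :: "'a::euclidean_space"
  assumes e: "e \<in> Basis" and c: "c \<in> Z" and s: "0 < s" "s < t"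
  shows "ennreal (unit_ball_vol (real (DIM('a) - 1)) * s ^ (DIM('a) - 1)) \<le>
    emeasure (PiM (Basis - {e}) (\<lambda>_. lborel))
      (slice_point e (c \<bullet> e) -` open_nbhd t Z \<inter> space (PiM (Basis - {e}) (\<lambda>_. lborel)))"
proof -
  let ?P = "PiM (Basis - {e}) (\<lambda>_. lborel :: real measure)"
  have card: "card (Basis - {e}) = DIM('a) - 1"
    using e by simp
  have "ennreal (unit_ball_vol (real (DIM('a) - 1)) * s ^ (DIM('a) - 1))
      = emeasure ?P ({f. sqrt (\<Sum>b\<in>Basis - {e}. (f b - c \<bullet> b)\<^sup>2) \<le> s} \<inter> space ?P)"
    using emeasure_PiM_ball[of "Basis - {e}" s "\<lambda>b. c \<bullet> b"] s(1) unfolding card by simp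
  also have "\<dots> \<le> emeasure ?P (slice_point e (c \<bullet> e) -` open_nbhd t Z \<inter> space ?P)"
  proof (rule emeasure_mono)
    have "slice_point e (c \<bullet> e) f \<in> open_nbhd t Z" if "sqrt (\<Sum>b\<in>Basis - {e}. (f b - c \<bullet> b)\<^sup>2) \<le> s" for f
    proof -
      have "norm (slice_point e (c \<bullet> e) f - c) < t"
        using that slice_point_diff_norm[OF e, of c f] s(2) by simp
      then show ?thesis
        unfolding open_nbhd_def using c by (auto intro!: bexI[of _ c] simp: dist_norm)
    qed
    then show "{f. sqrt (\<Sum>b\<in>Basis - {e}. (f b - c \<bullet> b)\<^sup>2) \<le> s} \<inter> space ?P
        \<subseteq> slice_point e (c \<bullet> e) -` open_nbhd t Z \<inter> space ?P"
      by auto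
    show "slice_point e (c \<bullet> e) -` open_nbhd t Z \<inter> space ?P \<in> sets ?P"
      by (intro measurable_sets[OF slice_point_measurable] borel_open open_open_nbhd)
  qed
  finally show ?thesis .
qed

text \<open>
By connectedness \<open>C\<close> meets every hyperplane between those of \<open>p\<close> and \<open>q\<close>.  The slice of the neighbourhood
there contains an \<open>(n-1)\<close>-dimensional ball of radius \<open>s\<close>, for every \<open>s < t\<close>.
\<close>

lemma nbhd_of_connected_volume_axis:
  fixes C :: "'a::euclidean_space set"
  assumes e: "e \<in> Basis" and C: "connected C" "p \<in> C" "q \<in> C" and pq: "p \<bullet> e \<le> q \<bullet> e" and t: "0 < t"
  shows "ennreal ((q \<bullet> e - p \<bullet> e) * (unit_ball_vol (real (DIM('a) - 1)) * t ^ (DIM('a) - 1)))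
    \<le> emeasure lborel (open_nbhd t C)"
proof (rule tendsto_upperbound)
  define w where "w s = unit_ball_vol (real (DIM('a) - 1)) * s ^ (DIM('a) - 1)" for s :: real
  show "((\<lambda>s. ennreal ((q \<bullet> e - p \<bullet> e) * (unit_ball_vol (real (DIM('a) - 1)) * s ^ (DIM('a) - 1)))) \<longlongrightarrow>
      ennreal ((q \<bullet> e - p \<bullet> e) * (unit_ball_vol (real (DIM('a) - 1)) * t ^ (DIM('a) - 1)))) (at_left t)"
    by (intro tendsto_intros)
  have "ennreal ((q \<bullet> e - p \<bullet> e) * w s) \<le> emeasure lborel (open_nbhd t C)" if s: "0 < s" "s < t" for s
  proof -
    let ?P = "PiM (Basis - {e}) (\<lambda>_. lborel :: real measure)"
    have w0: "0 \<le> w s"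
      using s by (simp add: w_def)
    have "ennreal ((q \<bullet> e - p \<bullet> e) * w s) = ennreal (w s) * emeasure lborel {p \<bullet> e..q \<bullet> e}"
      using pq w0 by (simp add: ennreal_mult' mult.commute)
    also have "\<dots> = (\<integral>\<^sup>+y. ennreal (w s) * indicator {p \<bullet> e..q \<bullet> e} y \<partial>lborel)"
      by (rule nn_integral_cmult_indicator[symmetric]) simp
    also have "\<dots> \<le> (\<integral>\<^sup>+y. emeasure ?P (slice_point e y -` open_nbhd t C \<inter> space ?P) \<partial>lborel)"
    proof (rule nn_integral_mono)
      fix y
      show "ennreal (w s) * indicator {p \<bullet> e..q \<bullet> e} y \<le> emeasure ?P (slice_point e y -` open_nbhd t C \<inter> space ?P)"
      proof (cases "y \<in> {p \<bullet> e..q \<bullet> e}")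
        case True
        then obtain c where c: "c \<in> C" "c \<bullet> e = y"
          using connected_ivt_hyperplane[OF C, of e y] by (auto simp: inner_commute)
        show ?thesis
          using slice_of_nbhd_contains_ball[OF e c(1) s] True by (simp add: c(2) w_def)
      qed simp
    qed
    also have "\<dots> = emeasure lborel (open_nbhd t C)"
      by (rule emeasure_lborel_slices[symmetric, OF borel_open[OF open_open_nbhd] e])
    finally show ?thesis .
  qed
  then show "\<forall>\<^sub>F s in at_left t. ennreal ((q \<bullet> e - p \<bullet> e) * (unit_ball_vol (real (DIM('a) - 1)) * s ^ (DIM('a) - 1)))
      \<le> emeasure lborel (open_nbhd t C)"
    unfolding eventually_at_left[OF t] w_def using t by blast
qed simp

lemma nbhd_of_connected_volume:
  fixes C :: "'a::euclidean_space set"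
  assumes C: "connected C" "p \<in> C" "q \<in> C" and t: "0 < t"
  shows "ennreal (dist p q * (unit_ball_vol (real (DIM('a) - 1)) * t ^ (DIM('a) - 1)))
    \<le> emeasure lborel (open_nbhd t C)"
proof (cases "p = q")
  case True
  then show ?thesis by simp
next
  case False
  define u where "u = (q - p) /\<^sub>R norm (q - p)"
  have u: "norm u = 1"
    using False by (simp add: u_def)
  obtain e :: 'a where e: "e \<in> Basis"
    using nonempty_Basis by blast
  obtain R where R: "orthogonal_transformation R" "R u = e"
    using reflection_swapping[OF u norm_Basis[OF e]] by metis
  have lin: "linear R"
    using R(1) by (rule orthogonal_transformation_linear)
  have "R q - R p = norm (q - p) *\<^sub>R R u"
    using False by (simp add: u_def linear_scale[OF lin] linear_diff[OF lin])
  then have "(R q - R p) \<bullet> e = dist p q"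
    using e R(2) by (simp add: dist_norm norm_minus_commute)
  then have d: "R q \<bullet> e - R p \<bullet> e = dist p q"
    by (simp add: inner_diff_left)
  have "connected (R ` C)"
    using lin by (intro connected_continuous_image C linear_continuous_on) (simp add: linear_conv_bounded_linear)
  then have "ennreal ((R q \<bullet> e - R p \<bullet> e) * (unit_ball_vol (real (DIM('a) - 1)) * t ^ (DIM('a) - 1)))
      \<le> emeasure lborel (open_nbhd t (R ` C))"
    using d C zero_le_dist[of p q] by (intro nbhd_of_connected_volume_axis[OF e _ _ _ _ t]) (auto simp del: zero_le_dist)
  then show ?thesis
    unfolding d emeasure_open_nbhd_orthogonal[OF R(1)] .
qed

text \<open>
The neighbourhood of a subset of a segment of length \<open>l\<close> lies in a cylinder of radius \<open>t\<close> and height \<open>l + 2 * t\<close>.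
\<close>

lemma nbhd_of_segment_volume_axis:
  fixes Z :: "'a::euclidean_space set"
  assumes e: "e \<in> Basis" and l: "0 \<le> l" and t: "0 < t"
    and Z: "\<And>x y b. x \<in> Z \<Longrightarrow> y \<in> Z \<Longrightarrow> b \<in> Basis - {e} \<Longrightarrow> x \<bullet> b = y \<bullet> b"
      "\<And>x. x \<in> Z \<Longrightarrow> x \<bullet> e \<in> {a..a + l}"
  shows "emeasure lborel (open_nbhd t Z)
    \<le> ennreal ((l + 2 * t) * (unit_ball_vol (real (DIM('a) - 1)) * t ^ (DIM('a) - 1)))"
proof (cases "Z = {}")
  case True
  then show ?thesis by (simp add: open_nbhd_def)
next
  case False
  then obtain z0 where z0: "z0 \<in> Z" by blast
  let ?P = "PiM (Basis - {e}) (\<lambda>_. lborel :: real measure)"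
  define w where "w = unit_ball_vol (real (DIM('a) - 1)) * t ^ (DIM('a) - 1)"
  have w0: "0 \<le> w"
    using t by (simp add: w_def)
  have card: "card (Basis - {e}) = DIM('a) - 1"
    using e by simp
  have ball: "emeasure ?P ({f. sqrt (\<Sum>b\<in>Basis - {e}. (f b - z0 \<bullet> b)\<^sup>2) \<le> t} \<inter> space ?P) = ennreal w"
    using emeasure_PiM_ball[of "Basis - {e}" t "\<lambda>b. z0 \<bullet> b"] t unfolding card w_def by simp
  have slice: "emeasure ?P (slice_point e y -` open_nbhd t Z \<inter> space ?P)
      \<le> ennreal w * indicator {a - t..a + l + t} y" for y
  proof -
    have in_slice: "sqrt (\<Sum>b\<in>Basis - {e}. (f b - z0 \<bullet> b)\<^sup>2) \<le> t \<and> y \<in> {a - t..a + l + t}"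
      if f: "slice_point e y f \<in> open_nbhd t Z" for f
    proof -
      obtain z where z: "z \<in> Z" "norm (slice_point e y f - z) < t"
        using f by (auto simp: open_nbhd_def dist_norm)
      have ye: "slice_point e y f \<bullet> e = y"
        using e by (simp add: slice_point_def inner_add_left inner_sum_left inner_Basis)
      have "\<bar>(slice_point e y f - z) \<bullet> e\<bar> < t"
        using Basis_le_norm[OF e] z(2) by (rule le_less_trans)
      then have y: "\<bar>y - z \<bullet> e\<bar> < t"
        by (simp add: inner_diff_left ye)
      have eq: "slice_point e y f - z = (y - z \<bullet> e) *\<^sub>R e + (slice_point e (z \<bullet> e) f - z)"
        by (simp add: slice_point_def algebra_simps)
      have "(slice_point e (z \<bullet> e) f - z) \<bullet> e = 0"
        using e by (simp add: slice_point_def inner_add_left inner_diff_left inner_sum_left inner_Basis)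
      then have "norm (slice_point e (z \<bullet> e) f - z) \<le> norm (slice_point e y f - z)"
        unfolding eq norm_le by (simp add: inner_add_left inner_add_right inner_commute inner_same_Basis[OF e])
      then have "sqrt (\<Sum>b\<in>Basis - {e}. (f b - z \<bullet> b)\<^sup>2) \<le> t"
        using z(2) unfolding slice_point_diff_norm[OF e] by simp
      also have "(\<Sum>b\<in>Basis - {e}. (f b - z \<bullet> b)\<^sup>2) = (\<Sum>b\<in>Basis - {e}. (f b - z0 \<bullet> b)\<^sup>2)"
        using Z(1)[OF z(1) z0] by (intro sum.cong) auto
      finally show ?thesis
        using y Z(2)[OF z(1)] by auto
    qed
    show ?thesis
    proof (cases "y \<in> {a - t..a + l + t}")
      case True
      have "emeasure ?P (slice_point e y -` open_nbhd t Z \<inter> space ?P)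
          \<le> emeasure ?P ({f. sqrt (\<Sum>b\<in>Basis - {e}. (f b - z0 \<bullet> b)\<^sup>2) \<le> t} \<inter> space ?P)"
      proof (rule emeasure_mono)
        have "{f \<in> space ?P. sqrt (\<Sum>b\<in>Basis - {e}. (f b - z0 \<bullet> b)\<^sup>2) \<le> t} \<in> sets ?P"
          by measurable
        also have "{f \<in> space ?P. sqrt (\<Sum>b\<in>Basis - {e}. (f b - z0 \<bullet> b)\<^sup>2) \<le> t}
            = {f. sqrt (\<Sum>b\<in>Basis - {e}. (f b - z0 \<bullet> b)\<^sup>2) \<le> t} \<inter> space ?P"
          by auto
        finally show "{f. sqrt (\<Sum>b\<in>Basis - {e}. (f b - z0 \<bullet> b)\<^sup>2) \<le> t} \<inter> space ?P \<in> sets ?P" .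
      qed (use in_slice in auto)
      then show ?thesis
        using True by (simp add: ball)
    next
      case False
      then have "slice_point e y -` open_nbhd t Z \<inter> space ?P = {}"
        using in_slice by blast
      then show ?thesis by simp
    qed
  qed
  have "emeasure lborel (open_nbhd t Z) = (\<integral>\<^sup>+y. emeasure ?P (slice_point e y -` open_nbhd t Z \<inter> space ?P) \<partial>lborel)"
    by (rule emeasure_lborel_slices[OF borel_open[OF open_open_nbhd] e])
  also have "\<dots> \<le> (\<integral>\<^sup>+y. ennreal w * indicator {a - t..a + l + t} y \<partial>lborel)"
    by (rule nn_integral_mono) (rule slice)
  also have "\<dots> = ennreal w * emeasure lborel {a - t..a + l + t}"
    by (rule nn_integral_cmult_indicator) simp
  also have "emeasure lborel {a - t..a + l + t} = ennreal (l + 2 * t)"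
    using l t by (simp add: algebra_simps)
  also have "ennreal w * ennreal (l + 2 * t) = ennreal ((l + 2 * t) * w)"
    using w0 l t by (simp add: ennreal_mult' mult.commute)
  finally show ?thesis
    unfolding w_def .
qed

lemma Liminf_add_le_ennreal:
  fixes f g :: "'b \<Rightarrow> ennreal"
  shows "Liminf F f + Liminf F g \<le> Liminf F (\<lambda>x. f x + g x)"
proof -
  have "Liminf F f + Liminf F g =
      (SUP P\<in>{P. eventually P F}. (INF x\<in>Collect P. f x) + (INF x\<in>Collect P. g x))"
    unfolding Liminf_def
  proof (rule SUP_add_directed_ennreal[symmetric])
    fix P Q assume "P \<in> {P. eventually P F}" "Q \<in> {P. eventually P F}"
    then show "\<exists>R\<in>{P. eventually P F}. (INF x\<in>Collect P. f x) + (INF x\<in>Collect Q. g x)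
        \<le> (INF x\<in>Collect R. f x) + (INF x\<in>Collect R. g x)"
      by (intro bexI[of _ "\<lambda>x. P x \<and> Q x"] add_mono INF_superset_mono) (auto intro: eventually_conj)
  qed
  also have "\<dots> \<le> Liminf F (\<lambda>x. f x + g x)"
    unfolding Liminf_def
  proof (rule SUP_mono)
    fix P assume P: "P \<in> {P. eventually P F}"
    show "\<exists>Q\<in>{P. eventually P F}. (INF x\<in>Collect P. f x) + (INF x\<in>Collect P. g x)
        \<le> (INF x\<in>Collect Q. f x + g x)"
      using P by (intro bexI[of _ P] INF_greatest add_mono INF_lower) auto
  qed
  finally show ?thesis .
qed

text \<open>
Superadditivity holds because small neighbourhoods of disjoint compact sets are disjoint.
\<close>

lemma length_content_lower_minkowski_content:
  "length_content (lower_minkowski_content 1 :: 'a::euclidean_space set \<Rightarrow> ennreal)"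
  unfolding length_content_def
proof (intro conjI allI impI)
  define w where "w t = unit_ball_vol (real (DIM('a) - 1)) * t ^ (DIM('a) - 1)" for t :: real
  have w: "0 < w t" if "0 < t" for t
    using that by (simp add: w_def)
  have M: "lower_minkowski_content 1 Z = Liminf (at_right 0) (\<lambda>t. emeasure lborel (open_nbhd t Z) / ennreal (w t))"
    for Z :: "'a set"
    by (simp add: lower_minkowski_content_def w_def)
  {
    fix A B :: "'a set" assume "A \<subseteq> B"
    then have "emeasure lborel (open_nbhd t A) \<le> emeasure lborel (open_nbhd t B)" for t
      using open_open_nbhd[of t B] by (intro emeasure_mono) (auto simp: open_nbhd_def)
    then show "lower_minkowski_content 1 A \<le> lower_minkowski_content 1 B"
      unfolding M by (intro Liminf_mono always_eventually allI divide_right_mono_ennreal)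
  next
    fix C :: "'a set" and p q assume C: "connected C" "p \<in> C" "q \<in> C"
    have "ennreal (dist p q) \<le> emeasure lborel (open_nbhd t C) / ennreal (w t)" if t: "0 < t" for t
    proof -
      have "ennreal (dist p q) = ennreal (dist p q * w t) / ennreal (w t)"
        using w[OF t] by (simp add: divide_ennreal)
      also have "\<dots> \<le> emeasure lborel (open_nbhd t C) / ennreal (w t)"
        unfolding w_def by (intro divide_right_mono_ennreal nbhd_of_connected_volume C t)
      finally show ?thesis .
    qed
    then show "ennreal (dist p q) \<le> lower_minkowski_content 1 C"
      unfolding M by (intro Liminf_bounded) (auto simp: eventually_at_filter)
  next
    fix A B :: "'a set" assume AB: "compact A" "compact B" "A \<inter> B = {}"
    obtain d where d: "d > 0" "\<And>a b. a \<in> A \<Longrightarrow> b \<in> B \<Longrightarrow> d \<le> dist a b"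
      using separate_compact_closed[OF AB(1) compact_imp_closed[OF AB(2)] AB(3)] by auto
    have add: "emeasure lborel (open_nbhd t A) / ennreal (w t) + emeasure lborel (open_nbhd t B) / ennreal (w t)
        = emeasure lborel (open_nbhd t (A \<union> B)) / ennreal (w t)" if t: "t < d / 2" for t
    proof -
      have "False" if "a \<in> A" "b \<in> B" "dist x a < t" "dist x b < t" for x a b
        using d(2)[OF that(1,2)] that(3,4) t dist_triangle3[of a b x] by linarith
      then have "open_nbhd t A \<inter> open_nbhd t B = {}"
        unfolding open_nbhd_def by blast
      then have "emeasure lborel (open_nbhd t A) + emeasure lborel (open_nbhd t B)
          = emeasure lborel (open_nbhd t A \<union> open_nbhd t B)"
        using open_open_nbhd[of t A] open_open_nbhd[of t B] by (intro plus_emeasure) auto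
      also have "open_nbhd t A \<union> open_nbhd t B = open_nbhd t (A \<union> B)"
        by (auto simp: open_nbhd_def)
      finally show ?thesis
        by (simp flip: add_divide_distrib_ennreal)
    qed
    have "lower_minkowski_content 1 A + lower_minkowski_content 1 B
        \<le> Liminf (at_right 0) (\<lambda>t. emeasure lborel (open_nbhd t A) / ennreal (w t) + emeasure lborel (open_nbhd t B) / ennreal (w t))"
      unfolding M by (rule Liminf_add_le_ennreal)
    also have "\<dots> \<le> lower_minkowski_content 1 (A \<union> B)"
      unfolding M
    proof (rule Liminf_mono)
      have "\<forall>\<^sub>F t in at_right 0. t < d / 2"
        unfolding eventually_at_right[OF zero_less_one] using d(1) by (intro exI[of _ "d / 2"]) simp
      then show "\<forall>\<^sub>F t in at_right 0. emeasure lborel (open_nbhd t A) / ennreal (w t) + emeasure lborel (open_nbhd t B) / ennreal (w t)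
          \<le> emeasure lborel (open_nbhd t (A \<union> B)) / ennreal (w t)"
        by eventually_elim (simp add: add)
    qed
    finally show "lower_minkowski_content 1 A + lower_minkowski_content 1 B \<le> lower_minkowski_content 1 (A \<union> B)" .
  }
qed

lemma lower_minkowski_content_segment_le:
  fixes Z :: "'a::euclidean_space set" and R :: "'a \<Rightarrow> 'a"
  assumes R: "orthogonal_transformation R" and e: "e \<in> Basis" and l: "0 \<le> l"
    and Z: "\<And>x y b. x \<in> Z \<Longrightarrow> y \<in> Z \<Longrightarrow> b \<in> Basis - {e} \<Longrightarrow> R x \<bullet> b = R y \<bullet> b"
      "\<And>x. x \<in> Z \<Longrightarrow> R x \<bullet> e \<in> {a..a + l}"
  shows "lower_minkowski_content 1 Z \<le> ennreal l"
proof -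
  define w where "w t = unit_ball_vol (real (DIM('a) - 1)) * t ^ (DIM('a) - 1)" for t :: real
  have w: "0 < w t" if "0 < t" for t
    using that by (simp add: w_def)
  have "lower_minkowski_content 1 Z = Liminf (at_right 0) (\<lambda>t. emeasure lborel (open_nbhd t Z) / ennreal (w t))"
    by (simp add: lower_minkowski_content_def w_def)
  also have "\<dots> \<le> Liminf (at_right 0) (\<lambda>t. ennreal (l + 2 * t))"
  proof (rule Liminf_mono)
    have "emeasure lborel (open_nbhd t Z) / ennreal (w t) \<le> ennreal (l + 2 * t)" if t: "0 < t" for t
    proof -
      have "emeasure lborel (open_nbhd t Z) = emeasure lborel (open_nbhd t (R ` Z))"
        by (rule emeasure_open_nbhd_orthogonal[OF R, symmetric])
      also have "\<dots> \<le> ennreal ((l + 2 * t) * w t)"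
        unfolding w_def by (rule nbhd_of_segment_volume_axis[OF e l t]) (use Z in auto)
      finally have "emeasure lborel (open_nbhd t Z) / ennreal (w t) \<le> ennreal ((l + 2 * t) * w t) / ennreal (w t)"
        by (rule divide_right_mono_ennreal)
      also have "\<dots> = ennreal (l + 2 * t)"
        using w[OF t] l t by (simp add: divide_ennreal)
      finally show ?thesis .
    qed
    then show "\<forall>\<^sub>F t in at_right 0. emeasure lborel (open_nbhd t Z) / ennreal (w t) \<le> ennreal (l + 2 * t)"
      by (auto simp: eventually_at_filter)
  qed
  also have "\<dots> = ennreal l"
  proof (rule lim_imp_Liminf)
    have "((\<lambda>t. ennreal (l + 2 * t)) \<longlongrightarrow> ennreal (l + 2 * 0)) (at_right 0)"
      by (intro tendsto_intros)
    then show "((\<lambda>t. ennreal (l + 2 * t)) \<longlongrightarrow> ennreal l) (at_right 0)"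
      by simp
  qed simp
  finally show ?thesis .
qed

section \<open>Sharpness\<close>

text \<open>
The reflection \<open>R\<close> takes the normal \<open>u\<close> of a thin slab to a basis vector \<open>e\<close>, so the projection along \<open>u\<close>
consists of the other coordinates of \<open>R x\<close>.
\<close>

lemma projection_with_short_fibers:
  fixes K :: "'a::euclidean_space set"
  assumes K: "convex_body K" and \<epsilon>: "0 < \<epsilon>"
  obtains f where "f \<in> continuous_maps_to K (DIM('a) - 1)"
    "\<And>y. hausdorff1 (fiber K f y) \<le> ennreal (min_width K + \<epsilon>)"
    "\<And>y. lower_minkowski_content 1 (fiber K f y) \<le> ennreal (min_width K + \<epsilon>)"
proof -
  define l where "l = min_width K + \<epsilon>"
  have l: "0 \<le> l"
    using min_width_pos[OF K] \<epsilon> by (simp add: l_def)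
  obtain u where u: "norm u = 1" "\<And>x y. x \<in> K \<Longrightarrow> y \<in> K \<Longrightarrow> u \<bullet> (y - x) \<le> l"
    using thin_slab[OF K \<epsilon>] unfolding l_def by metis
  obtain p where p: "p \<in> K" "\<And>x. x \<in> K \<Longrightarrow> u \<bullet> p \<le> u \<bullet> x"
    using extreme_points_in_direction[OF K, of u] by metis
  obtain e :: 'a where e: "e \<in> Basis"
    using nonempty_Basis by blast
  obtain R where R: "orthogonal_transformation R" "R u = e"
    using reflection_swapping[OF u(1) norm_Basis[OF e]] by metis
  have lin: "linear R"
    using R(1) by (rule orthogonal_transformation_linear)
  have Re: "R x \<bullet> e = u \<bullet> x" for x
    using R by (metis inner_commute orthogonal_transformation_def)
  define k where "k = DIM('a) - 1"
  have "card (Basis - {e}) = k"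
    using e by (simp add: k_def)
  then obtain b where b: "bij_betw b {..<k} (Basis - {e})"
    using ex_bij_betw_nat_finite[of "Basis - {e}"] by (auto simp: atLeast0LessThan)
  define f where "f x i = (if i < k then R x \<bullet> b i else 0)" for x i
  have cR: "continuous_on K R"
    using lin by (intro linear_continuous_on) (simp add: linear_conv_bounded_linear)
  have "continuous_on K (\<lambda>x. f x i)" for i
    unfolding f_def by (cases "i < k") (auto intro!: continuous_intros cR)
  then have f: "f \<in> continuous_maps_to K k"
    unfolding continuous_maps_to_def Euclidean_space_def continuous_map_in_subtopology
      continuous_map_componentwise_UNIV by (auto simp: f_def)
  have same: "R x \<bullet> c = R x' \<bullet> c"
    if "x \<in> fiber K f y" "x' \<in> fiber K f y" "c \<in> Basis - {e}" for x x' y c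
  proof -
    obtain i where i: "i < k" "c = b i"
      using b \<open>c \<in> Basis - {e}\<close> by (auto simp: bij_betw_def)
    have "f x i = f x' i"
      using that by (auto simp: fiber_def)
    then show ?thesis
      using i by (simp add: f_def)
  qed
  show thesis
  proof (rule that[of f])
    show "f \<in> continuous_maps_to K (DIM('a) - 1)"
      using f by (simp add: k_def)
    fix y
    show "hausdorff1 (fiber K f y) \<le> ennreal (min_width K + \<epsilon>)"
      unfolding l_def[symmetric]
    proof (rule hausdorff1_thin_le[OF _ l])
      have "bounded K"
        using K by (simp add: convex_body_def compact_imp_bounded)
      then show "bounded (fiber K f y)"
        by (rule bounded_subset) (auto simp: fiber_def)
      fix x x' assume x: "x \<in> fiber K f y" "x' \<in> fiber K f y"
      have "R x - R x' = (u \<bullet> x - u \<bullet> x') *\<^sub>R e"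
      proof (rule euclidean_eqI)
        fix c :: 'a assume c: "c \<in> Basis"
        show "(R x - R x') \<bullet> c = (u \<bullet> x - u \<bullet> x') *\<^sub>R e \<bullet> c"
        proof (cases "c = e")
          case True
          then show ?thesis
            using e by (simp add: inner_diff_left Re)
        next
          case False
          then show ?thesis
            using same[OF x, of c] c e by (simp add: inner_diff_left inner_Basis)
        qed
      qed
      moreover have "dist x x' = norm (R x - R x')"
        using orthogonal_transformation_norm[OF R(1), of "x - x'"] linear_diff[OF lin] by (simp add: dist_norm)
      ultimately show "dist x x' \<le> \<bar>u \<bullet> x - u \<bullet> x'\<bar>"
        using e by simp
      have "x \<in> K" "x' \<in> K"
        using x by (auto simp: fiber_def)
      then show "\<bar>u \<bullet> x - u \<bullet> x'\<bar> \<le> l"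
        using u(2)[of x x'] u(2)[of x' x] by (simp add: inner_diff_right abs_le_iff)
    qed
    show "lower_minkowski_content 1 (fiber K f y) \<le> ennreal (min_width K + \<epsilon>)"
      unfolding l_def[symmetric]
    proof (rule lower_minkowski_content_segment_le[OF R(1) e l same])
      fix x assume "x \<in> fiber K f y"
      then have "x \<in> K" by (simp add: fiber_def)
      then show "R x \<bullet> e \<in> {u \<bullet> p..u \<bullet> p + l}"
        using p u(2)[OF p(1), of x] by (simp add: Re inner_diff_right)
    qed
  qed
qed

lemma waist_eq_min_width:
  fixes K :: "'a::euclidean_space set"
  assumes K: "convex_body K" and \<nu>: "length_content \<nu>"
    and small: "\<And>\<epsilon>. 0 < \<epsilon> \<Longrightarrow>
      \<exists>f \<in> continuous_maps_to K (DIM('a) - 1). \<forall>y. \<nu> (fiber K f y) \<le> ennreal (min_width K + \<epsilon>)"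
  shows "(INF f \<in> continuous_maps_to K (DIM('a) - 1).
            SUP y \<in> topspace (Euclidean_space (DIM('a) - 1)). \<nu> (fiber K f y)) = ennreal (min_width K)"
    (is "?waist = _")
proof (rule antisym)
  show "?waist \<le> ennreal (min_width K)"
  proof (rule ennreal_le_epsilon)
    fix \<epsilon> :: real assume "0 < \<epsilon>"
    then obtain f where f: "f \<in> continuous_maps_to K (DIM('a) - 1)"
      "\<And>y. \<nu> (fiber K f y) \<le> ennreal (min_width K + \<epsilon>)"
      using small by blast
    have "?waist \<le> (SUP y \<in> topspace (Euclidean_space (DIM('a) - 1)). \<nu> (fiber K f y))"
      by (rule INF_lower[OF f(1)])
    also have "\<dots> \<le> ennreal (min_width K + \<epsilon>)"
      by (intro SUP_least f(2))
    also have "\<dots> = ennreal (min_width K) + ennreal \<epsilon>"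
      using min_width_pos[OF K] \<open>0 < \<epsilon>\<close> by (intro ennreal_plus) auto
    finally show "?waist \<le> ennreal (min_width K) + ennreal \<epsilon>" .
  qed
  show "ennreal (min_width K) \<le> ?waist"
  proof (rule INF_greatest)
    fix f assume "f \<in> continuous_maps_to K (DIM('a) - 1)"
    then obtain y where y: "y \<in> topspace (Euclidean_space (DIM('a) - 1))" "ennreal (min_width K) \<le> \<nu> (fiber K f y)"
      using fiber_of_large_content[OF K \<nu>] by blast
    show "ennreal (min_width K) \<le> (SUP y \<in> topspace (Euclidean_space (DIM('a) - 1)). \<nu> (fiber K f y))"
      by (rule order_trans[OF y(2)]) (rule SUP_upper[OF y(1)])
  qed
qed

theorem theorem5p5:
  fixes K :: "'a::euclidean_space set"
  assumes "convex_body K"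
  shows "(\<forall>f \<in> continuous_maps_to K (DIM('a) - 1).
            \<exists>y \<in> topspace (Euclidean_space (DIM('a) - 1)).
              hausdorff1 (fiber K f y) \<ge> ennreal (min_width K)) \<and>
         (INF f \<in> continuous_maps_to K (DIM('a) - 1).
            SUP y \<in> topspace (Euclidean_space (DIM('a) - 1)). hausdorff1 (fiber K f y))
           = ennreal (min_width K) \<and>
         minkowski_waist 1 K = ennreal (min_width K)"
proof (intro conjI)
  show "\<forall>f \<in> continuous_maps_to K (DIM('a) - 1).
      \<exists>y \<in> topspace (Euclidean_space (DIM('a) - 1)). hausdorff1 (fiber K f y) \<ge> ennreal (min_width K)"
    using fiber_of_large_content[OF assms length_content_hausdorff1] by blast
  show "(INF f \<in> continuous_maps_to K (DIM('a) - 1).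
      SUP y \<in> topspace (Euclidean_space (DIM('a) - 1)). hausdorff1 (fiber K f y)) = ennreal (min_width K)"
    by (rule waist_eq_min_width[OF assms length_content_hausdorff1])
      (metis projection_with_short_fibers[OF assms])
  show "minkowski_waist 1 K = ennreal (min_width K)"
    unfolding minkowski_waist_def
    by (rule waist_eq_min_width[OF assms length_content_lower_minkowski_content])
      (metis projection_with_short_fibers[OF assms])
qed

end
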